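(* Let $H$ be a definite Hamiltonian on $(a,b)$. Further, let $r_0\ge 0$, $c_-,c_+>0$, assume that $(\hat t,\hat s)$ is a compatible pair for $H,r_0$ with constants $c_-,c_+$, and let $K_H(t;r)$ be the kernel defined below. Then, for $x\in\operatorname{dom}H$, \[ \log|w_{H,22}(x;ir)| \asymp \int_a^x K_H(t;r)\,\mathrm{d}t, \qquad r>r_0. \] The constants implicit in the relation `$\asymp$' depend on $c_-,c_+$ but not on $H,x,r_0,\hat t,\hat s$.
   Context: Let $-\infty<a<b\le\infty$. A Hamiltonian on $(a,b)$ is a measurable function $H:(a,b)\to\mathbb{R}^{2\times 2}$ with $H\in L^1((a,c),\mathbb{R}^{2\times2})$ for all $c\in(a,b)$, $H(t)\ge 0$ for a.e. $t$, and $\{t:H(t)=0\}$ of measure zero; write $H=\begin{pmatrix}h_1&h_3\\ h_3&h_2\end{pmatrix}$. $\operatorname{dom}H:=[a,b]$ if $\int_a^b\operatorname{tr}H<\infty$ (limit circle case) and $[a,b)$ otherwise. With $\xi_\phi:=(\cos\phi,\sin\phi)^T$, $H$ is definite if there is no $\phi$ with $H(t)=\operatorname{tr}H(t)\,\xi_\phi\xi_\phi^T$ for a.e. $t\in(a,b)$. Set $\Omega(s,t):=\int_s^tH(u)\,\mathrm{d}u$ and $\omega_j(s,t):=\int_s^t h_j(u)\,\mathrm{d}u$. A compatible pair $(\hat t,\hat s)$ for $H,r_0$ with constants $c_-,c_+$ consists of $\hat t:(r_0,\infty)\to(a,b)$ with $\frac{c_-}{r^2}\le\det\Omega(a,\hat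 t(r))\le\frac{c_+}{r^2}$, and $\hat s$ defined on $\{(t,r)\in(a,b)\times(r_0,\infty): t\ge\hat t(r)\}$ with values in $[a,b)$, $\hat s(t;r)\le t$ and $\frac{c_-}{r^2}\le\det\Omega(\hat s(t;r),t)\le\frac{c_+}{r^2}$. The kernel is \[ K_H(t;r):=\mathbf{1}_{[a,\hat t(r))}(t)\frac{\omega_2(a,t)h_1(t)}{\frac{c_+}{r^2}+(\omega_3(a,t))^2}+\mathbf{1}_{[\hat t(r),b)}(t)\frac{h_1(t)}{\omega_1(\hat s(t;r),t)}. \] $W_H(t;z)=(w_{H,ij}(t;z))_{i,j=1}^2$ is the fundamental solution, i.e. the solution of $\frac{\partial}{\partial t}W_H(t;z)J=zW_H(t;z)H(t)$, $W_H(a;z)=I$, with $J=\begin{pmatrix}0&-1\\1&0\end{pmatrix}$. $f\asymp g$ means $c_1g\le f\le c_2g$ for some constants $c_1,c_2>0$. *)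

theory Defs
  imports "HOL-Analysis.Analysis"
begin

text \<open>A Hamiltonian H = [[h1,h3],[h3,h2]] on the interval (a,b), with a real and
  b an extended real (b may be +infinity).\<close>

definition ivl :: "real \<Rightarrow> ereal \<Rightarrow> real set" where
  "ivl a b = {t. a < t \<and> ereal t < b}"

definition hamiltonian ::
  "real \<Rightarrow> ereal \<Rightarrow> (real \<Rightarrow> real) \<Rightarrow> (real \<Rightarrow> real) \<Rightarrow> (real \<Rightarrow> real) \<Rightarrow> bool" where
  "hamiltonian a b h1 h2 h3 \<longleftrightarrow>
     ereal a < b \<and>
     h1 \<in> borel_measurable lborel \<and> h2 \<in> borel_measurable lborel \<and> h3 \<in> borel_measurable lborel \<and>
     (\<forall>c. a < c \<and> ereal c < b \<longrightarrow>
        set_integrable lborel {a<..<c} h1 \<and> set_integrable lborel {a<..<c} h2 \<and>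
        set_integrable lborel {a<..<c} h3) \<and>
     (AE t in lborel. t \<in> ivl a b \<longrightarrow>
        (\<forall>u v. h1 t * u\<^sup>2 + 2 * h3 t * u * v + h2 t * v\<^sup>2 \<ge> 0)) \<and>
     (AE t in lborel. t \<in> ivl a b \<longrightarrow> \<not> (h1 t = 0 \<and> h2 t = 0 \<and> h3 t = 0))"

definition definite ::
  "real \<Rightarrow> ereal \<Rightarrow> (real \<Rightarrow> real) \<Rightarrow> (real \<Rightarrow> real) \<Rightarrow> (real \<Rightarrow> real) \<Rightarrow> bool" where
  "definite a b h1 h2 h3 \<longleftrightarrow>
     \<not> (\<exists>\<phi>::real. AE t in lborel. t \<in> ivl a b \<longrightarrow>
          h1 t = (h1 t + h2 t) * (cos \<phi>)\<^sup>2 \<and>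
          h2 t = (h1 t + h2 t) * (sin \<phi>)\<^sup>2 \<and>
          h3 t = (h1 t + h2 t) * (cos \<phi> * sin \<phi>))"

definition limit_circle ::
  "real \<Rightarrow> ereal \<Rightarrow> (real \<Rightarrow> real) \<Rightarrow> (real \<Rightarrow> real) \<Rightarrow> bool" where
  "limit_circle a b h1 h2 \<longleftrightarrow> (\<integral>\<^sup>+ t\<in>ivl a b. ennreal (h1 t + h2 t) \<partial>lborel) < \<infinity>"

definition domH ::
  "real \<Rightarrow> ereal \<Rightarrow> (real \<Rightarrow> real) \<Rightarrow> (real \<Rightarrow> real) \<Rightarrow> ereal set" where
  "domH a b h1 h2 = {x. ereal a \<le> x \<and> (x < b \<or> (x = b \<and> limit_circle a b h1 h2))}"

definition omega :: "(real \<Rightarrow> real) \<Rightarrow> real \<Rightarrow> real \<Rightarrow> real" where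
  "omega h s t = (LINT u:{s..t}|lborel. h u)"

definition detOmega ::
  "(real \<Rightarrow> real) \<Rightarrow> (real \<Rightarrow> real) \<Rightarrow> (real \<Rightarrow> real) \<Rightarrow> real \<Rightarrow> real \<Rightarrow> real" where
  "detOmega h1 h2 h3 s t = omega h1 s t * omega h2 s t - (omega h3 s t)\<^sup>2"

definition compatible_pair ::
  "real \<Rightarrow> ereal \<Rightarrow> (real \<Rightarrow> real) \<Rightarrow> (real \<Rightarrow> real) \<Rightarrow> (real \<Rightarrow> real) \<Rightarrow> real \<Rightarrow> real \<Rightarrow> real
   \<Rightarrow> (real \<Rightarrow> real) \<Rightarrow> (real \<Rightarrow> real \<Rightarrow> real) \<Rightarrow> bool" where
  "compatible_pair a b h1 h2 h3 r0 cm cp that shat \<longleftrightarrow>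
     (\<forall>r. r > r0 \<longrightarrow> that r \<in> ivl a b \<and>
        cm / r\<^sup>2 \<le> detOmega h1 h2 h3 a (that r) \<and> detOmega h1 h2 h3 a (that r) \<le> cp / r\<^sup>2) \<and>
     (\<forall>r t. r > r0 \<and> t \<in> ivl a b \<and> t \<ge> that r \<longrightarrow>
        a \<le> shat t r \<and> ereal (shat t r) < b \<and> shat t r \<le> t \<and>
        cm / r\<^sup>2 \<le> detOmega h1 h2 h3 (shat t r) t \<and> detOmega h1 h2 h3 (shat t r) t \<le> cp / r\<^sup>2)"

definition kernel ::
  "real \<Rightarrow> ereal \<Rightarrow> (real \<Rightarrow> real) \<Rightarrow> (real \<Rightarrow> real) \<Rightarrow> (real \<Rightarrow> real) \<Rightarrow> real
   \<Rightarrow> (real \<Rightarrow> real) \<Rightarrow> (real \<Rightarrow> real \<Rightarrow> real) \<Rightarrow> real \<Rightarrow> real \<Rightarrow> real" where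
  "kernel a b h1 h2 h3 cp that shat t r =
     (if a \<le> t \<and> t < that r
      then omega h2 a t * h1 t / (cp / r\<^sup>2 + (omega h3 a t)\<^sup>2) else 0) +
     (if that r \<le> t \<and> ereal t < b
      then h1 t / omega h1 (shat t r) t else 0)"

definition hmat ::
  "(real \<Rightarrow> real) \<Rightarrow> (real \<Rightarrow> real) \<Rightarrow> (real \<Rightarrow> real) \<Rightarrow> real \<Rightarrow> complex^2^2" where
  "hmat h1 h2 h3 t = (\<chi> i j. complex_of_real
      (if i = 1 \<and> j = 1 then h1 t else if i = 2 \<and> j = 2 then h2 t else h3 t))"

definition Jmat :: "complex^2^2" where
  "Jmat = (\<chi> i j. if i = 1 \<and> j = 2 then -1 else if i = 2 \<and> j = 1 then 1 else 0)"

text \<open>W is the fundamental solution of (d/dt W) J = z W H, W(a) = I, written in its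
  (equivalent, absolutely continuous) integral form W(x) = I - (integral_a^x W H J) z,
  for every point x of dom H (including x = b = infinity in the limit circle case).\<close>
definition fundamental_solution ::
  "real \<Rightarrow> ereal \<Rightarrow> (real \<Rightarrow> real) \<Rightarrow> (real \<Rightarrow> real) \<Rightarrow> (real \<Rightarrow> real)
   \<Rightarrow> (ereal \<Rightarrow> complex \<Rightarrow> complex^2^2) \<Rightarrow> bool" where
  "fundamental_solution a b h1 h2 h3 W \<longleftrightarrow>
     (\<forall>x \<in> domH a b h1 h2. \<forall>z.
        set_integrable lborel {t. a \<le> t \<and> ereal t \<le> x}
          (\<lambda>t. W (ereal t) z ** hmat h1 h2 h3 t ** Jmat) \<and>
        W x z = mat 1 - (LINT t:{t. a \<le> t \<and> ereal t \<le> x}|lborel.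
                           W (ereal t) z ** hmat h1 h2 h3 t ** Jmat) ** mat z)"

end

theory Submission
  imports Defs
begin

text \<open>
  Let (y1, y2) be the lower row of the fundamental solution at z = ir and E = Im (y2 * cnj y1).
  The equation gives E' = r yHy* and (log |y2|)' = r h1 E / |y2|^2, so it suffices to compare
  r E(t) / |y2(t)|^2 with the factor of h1(t) in the kernel. For s < t put N = \<integral>_s^t yHy*.
  Cauchy-Schwarz bounds the variation of y over [s,t] in the seminorm of H and yields
  y(t) \<Omega>(s,t) y(t)* \<le> (2 + 4 r^2 det \<Omega>(s,t)) N. Completing the square in this quadratic form, and
  using r N \<le> E, gives both bounds for t \<ge> that(r) with s = shat(t;r). For t < that(r) take s = a;
  then r N = E, and the initial condition y1(a) = 0 adds the estimate |y1(t)|^2 \<le> r^2 N \<omega>2(a,t).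
\<close>

section \<open>Indefinite Lebesgue integrals\<close>

text \<open>The constants do not depend on H because the seminorm estimate involves the data only
  through r^2 det \<Omega>(s,t), which compatibility keeps below cp: thus \<kappa> = 2 + 4 cp serves
  for every t. For t \<ge> that(r) the lower bound cm / r^2 keeps \<Omega>(s,t) away from
  degeneracy, and the square is completed at \<omega>1. Before that(r) no such lower bound exists,
  since det \<Omega>(a,t) starts at 0; there the square is completed at \<omega>2, and the vanishing
  of y1(a) makes up for the lost determinant. The two pieces of the kernel fit together: \<omega>1
  \<omega>2 = det \<Omega> + \<omega>3^2, so once det \<Omega>(a,t) is of size 1 / r^2, the quotient
  of \<omega>2 by cp / r^2 + \<omega>3^2 is comparable to 1 / \<omega>1. The entries of H are only
  locally integrable, so the derivatives above exist merely almost everywhere; the product rule and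
  the logarithmic derivative are therefore established for indefinite integrals by estimating
  increments.\<close>

lemma set_integral_split_Icc:
  fixes f :: "real \<Rightarrow> 'a::euclidean_space"
  assumes "set_integrable lborel {a..c} f" "a \<le> s" "s \<le> c"
  shows "(LINT u:{a..c}|lborel. f u) = (LINT u:{a..s}|lborel. f u) + (LINT u:{s..c}|lborel. f u)"
proof -
  have 1: "set_integrable lborel {a..s} f" "set_integrable lborel {s..c} f"
    using assms by (auto intro: set_integrable_subset)
  show ?thesis
    unfolding set_borel_integral_eq_integral(2)[OF assms(1)] set_borel_integral_eq_integral(2)[OF 1(1)]
      set_borel_integral_eq_integral(2)[OF 1(2)]
    using assms by (intro Henstock_Kurzweil_Integration.integral_combine[symmetric] set_borel_integral_eq_integral)
qed

lemma continuous_on_set_integral_Icc: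
  fixes f :: "real \<Rightarrow> 'a::euclidean_space"
  assumes "set_integrable lborel {a..c} f"
  shows "continuous_on {a..c} (\<lambda>x. LINT u:{a..x}|lborel. f u)"
proof (rule continuous_on_eq)
  show "continuous_on {a..c} (\<lambda>x. integral {a..x} f)"
    using assms by (intro indefinite_integral_continuous_1 set_borel_integral_eq_integral)
  fix x assume "x \<in> {a..c}"
  then have "set_integrable lborel {a..x} f"
    by (intro set_integrable_subset[OF assms]) auto
  then show "integral {a..x} f = (LINT u:{a..x}|lborel. f u)"
    by (rule set_borel_integral_eq_integral(2)[symmetric])
qed

lemma set_integrable_continuous_mult:
  fixes \<phi> f :: "real \<Rightarrow> 'a::{real_normed_field, euclidean_space}"
  assumes "continuous_on {a..c} \<phi>" "set_integrable lborel {a..c} f"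
  shows "set_integrable lborel {a..c} (\<lambda>u. \<phi> u * f u)"
proof -
  have "compact (\<phi> ` {a..c})"
    using assms(1) by (intro compact_continuous_image) auto
  then obtain B where B: "\<And>u. u \<in> {a..c} \<Longrightarrow> norm (\<phi> u) \<le> B"
    by (meson bounded_iff compact_imp_bounded image_eqI)
  have m: "(\<lambda>u. indicator {a..c} u *\<^sub>R \<phi> u) \<in> borel_measurable borel"
    using assms(1) by (intro borel_measurable_continuous_on_indicator) auto
  have f: "integrable lborel (\<lambda>u. indicator {a..c} u *\<^sub>R f u)"
    using assms(2) unfolding set_integrable_def .
  show ?thesis
    unfolding set_integrable_def
  proof (rule Bochner_Integration.integrable_bound)
    show "integrable lborel (\<lambda>u. B *\<^sub>R (indicator {a..c} u *\<^sub>R f u))"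
      using f by (intro integrable_scaleR_right)
    have "(\<lambda>u. (indicator {a..c} u *\<^sub>R \<phi> u) * (indicator {a..c} u *\<^sub>R f u)) \<in> borel_measurable lborel"
      using m f by (intro borel_measurable_times) auto
    then show "(\<lambda>u. indicator {a..c} u *\<^sub>R (\<phi> u * f u)) \<in> borel_measurable lborel"
      by (rule measurable_cong[THEN iffD1, rotated]) (auto simp: indicator_def)
    show "AE u in lborel. norm (indicator {a..c} u *\<^sub>R (\<phi> u * f u)) \<le> norm (B *\<^sub>R (indicator {a..c} u *\<^sub>R f u))"
    proof (rule AE_I2)
      fix u
      show "norm (indicator {a..c} u *\<^sub>R (\<phi> u * f u)) \<le> norm (B *\<^sub>R (indicator {a..c} u *\<^sub>R f u))"
        using B[of u] by (auto simp: indicator_def norm_mult intro!: mult_right_mono)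
    qed
  qed
qed

lemma norm_set_integral_mult_le:
  fixes \<phi> f :: "real \<Rightarrow> 'a::{real_normed_field, euclidean_space}"
  assumes \<phi>: "continuous_on {s..t} \<phi>" "\<And>u. u \<in> {s..t} \<Longrightarrow> norm (\<phi> u) \<le> \<epsilon>"
    and f: "set_integrable lborel {s..t} f"
  shows "norm (LINT u:{s..t}|lborel. \<phi> u * f u) \<le> \<epsilon> * (LINT u:{s..t}|lborel. norm (f u))"
proof -
  have i: "set_integrable lborel {s..t} (\<lambda>u. \<phi> u * f u)"
    using assms by (intro set_integrable_continuous_mult)
  have "norm (LINT u:{s..t}|lborel. \<phi> u * f u) \<le> (LINT u|lborel. norm (indicator {s..t} u *\<^sub>R (\<phi> u * f u)))"
    unfolding set_lebesgue_integral_def by (rule integral_norm_bound)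
  also have "\<dots> \<le> (LINT u|lborel. \<epsilon> * norm (indicator {s..t} u *\<^sub>R f u))"
  proof (rule integral_mono)
    show "integrable lborel (\<lambda>u. norm (indicator {s..t} u *\<^sub>R (\<phi> u * f u)))"
      using i unfolding set_integrable_def by (rule integrable_norm)
    show "integrable lborel (\<lambda>u. \<epsilon> * norm (indicator {s..t} u *\<^sub>R f u))"
      using f unfolding set_integrable_def by (intro integrable_mult_right integrable_norm)
    fix u
    show "norm (indicator {s..t} u *\<^sub>R (\<phi> u * f u)) \<le> \<epsilon> * norm (indicator {s..t} u *\<^sub>R f u)"
      using \<phi>(2)[of u] by (auto simp: indicator_def norm_mult intro!: mult_right_mono)
  qed
  also have "\<dots> = \<epsilon> * (LINT u:{s..t}|lborel. norm (f u))"
    by (simp add: set_lebesgue_integral_def)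
  finally show ?thesis .
qed

text \<open>Over a fine subdivision the bounds telescope to \<epsilon> * (M b - M a), and \<epsilon>
  is arbitrary. This takes the place of "zero derivative implies constant" for functions that are
  only indefinite integrals.\<close>

lemma eq_if_increments_negligible:
  fixes D :: "real \<Rightarrow> 'a::real_normed_vector" and M :: "real \<Rightarrow> real"
  assumes "a \<le> b"
    and small: "\<And>\<epsilon>. \<epsilon> > 0 \<Longrightarrow> \<exists>\<delta>>0. \<forall>s t. a \<le> s \<and> s \<le> t \<and> t \<le> b \<and> t - s < \<delta> \<longrightarrow>
                  norm (D t - D s) \<le> \<epsilon> * (M t - M s)"
  shows "D b = D a"
proof -
  have bound: "norm (D b - D a) \<le> \<epsilon> * (M b - M a)" if \<epsilon>: "\<epsilon> > 0" for \<epsilon>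
  proof -
    obtain \<delta> where "\<delta> > 0" and \<delta>: "\<And>s t. a \<le> s \<Longrightarrow> s \<le> t \<Longrightarrow> t \<le> b \<Longrightarrow> t - s < \<delta> \<Longrightarrow>
        norm (D t - D s) \<le> \<epsilon> * (M t - M s)"
      using small[OF \<epsilon>] by blast
    obtain n :: nat where n: "(b - a) / \<delta> < real n"
      using reals_Archimedean2 by blast
    have "real n > 0"
      using n \<open>\<delta> > 0\<close> \<open>a \<le> b\<close> by (smt (verit) divide_nonneg_pos)
    then have step: "(b - a) / real n < \<delta>"
      using n \<open>\<delta> > 0\<close> by (simp add: field_simps)
    define p where "p i = a + real i * ((b - a) / real n)" for i
    have p_Suc: "p (Suc i) = p i + (b - a) / real n" for i
      by (simp add: p_def distrib_right add_divide_distrib)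
    have step0: "0 \<le> (b - a) / real n"
      using \<open>a \<le> b\<close> by simp
    have "norm (D (p i) - D a) \<le> \<epsilon> * (M (p i) - M a)" if "i \<le> n" for i
      using that
    proof (induction i)
      case 0
      then show ?case by (simp add: p_def)
    next
      case (Suc i)
      have "real (Suc i) * ((b - a) / real n) \<le> real n * ((b - a) / real n)"
        using Suc.prems step0 by (intro mult_right_mono) auto
      then have "p (Suc i) \<le> b"
        using \<open>real n > 0\<close> by (simp add: p_def)
      moreover have "a \<le> p i"
        using mult_nonneg_nonneg[OF of_nat_0_le_iff step0, of i] by (simp add: p_def)
      ultimately have "norm (D (p (Suc i)) - D (p i)) \<le> \<epsilon> * (M (p (Suc i)) - M (p i))"
        using step step0 by (intro \<delta>) (auto simp: p_Suc)
      moreover have "norm (D (p i) - D a) \<le> \<epsilon> * (M (p i) - M a)"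
        using Suc by simp
      moreover have "norm (D (p (Suc i)) - D a) \<le> norm (D (p (Suc i)) - D (p i)) + norm (D (p i) - D a)"
        using norm_triangle_ineq[of "D (p (Suc i)) - D (p i)" "D (p i) - D a"] by simp
      ultimately show ?case
        by (simp add: algebra_simps)
    qed
    from this[of n] show ?thesis
      using \<open>real n > 0\<close> by (simp add: p_def)
  qed
  show ?thesis
  proof (rule ccontr)
    assume "D b \<noteq> D a"
    then have pos: "norm (D b - D a) > 0" by simp
    \<comment> \<open>The summand 1 keeps the divisor in \<open>\<epsilon>\<close> positive even if
      \<open>M b = M a\<close>.\<close>
    define m where "m = 1 + \<bar>M b - M a\<bar>"
    have m: "m > 0" unfolding m_def by (intro add_pos_nonneg) auto
    define \<epsilon> where "\<epsilon> = norm (D b - D a) / (2 * m)"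
    have "\<epsilon> > 0" unfolding \<epsilon>_def using pos m by simp
    then have "norm (D b - D a) \<le> \<epsilon> * m"
      unfolding m_def using bound[of \<epsilon>] by (smt (verit, best) mult_left_mono)
    also have "\<dots> = norm (D b - D a) / 2"
      using m by (simp add: \<epsilon>_def)
    finally show False using pos by simp
  qed
qed

text \<open>On a short interval the error consists of f weighted with G t - G u and g weighted with
  F s - F u. Uniform continuity makes both weights small, and the integrals of |f| and |g| form the
  majorant \<open>M\<close>.\<close>

lemma set_integral_by_parts_Icc:
  fixes F G f g :: "real \<Rightarrow> 'a::{real_normed_field, euclidean_space}"
  assumes "a \<le> c"
    and f: "set_integrable lborel {a..c} f" and g: "set_integrable lborel {a..c} g"
    and F: "\<And>x. x \<in> {a..c} \<Longrightarrow> F x = F a + (LINT u:{a..x}|lborel. f u)"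
    and G: "\<And>x. x \<in> {a..c} \<Longrightarrow> G x = G a + (LINT u:{a..x}|lborel. g u)"
  shows "F c * G c = F a * G a + (LINT u:{a..c}|lborel. G u * f u + F u * g u)"
proof -
  have cF: "continuous_on {a..c} F"
    by (rule continuous_on_eq[where f="\<lambda>x. F a + (LINT u:{a..x}|lborel. f u)"])
       (intro continuous_intros continuous_on_set_integral_Icc[OF f], rule F[symmetric])
  have cG: "continuous_on {a..c} G"
    by (rule continuous_on_eq[where f="\<lambda>x. G a + (LINT u:{a..x}|lborel. g u)"])
       (intro continuous_intros continuous_on_set_integral_Icc[OF g], rule G[symmetric])
  define k where "k u = G u * f u + F u * g u" for u
  have k: "set_integrable lborel {a..c} k"
    unfolding k_def using cF cG f g by (intro set_integral_add set_integrable_continuous_mult)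
  have nf: "set_integrable lborel {a..c} (\<lambda>u. norm (f u))"
    and ng: "set_integrable lborel {a..c} (\<lambda>u. norm (g u))"
    using integrable_norm[OF f[unfolded set_integrable_def]] integrable_norm[OF g[unfolded set_integrable_def]]
    by (auto simp: set_integrable_def)
  define D where "D x = F x * G x - (LINT u:{a..x}|lborel. k u)" for x
  define M where "M x = (LINT u:{a..x}|lborel. norm (f u)) + (LINT u:{a..x}|lborel. norm (g u))" for x
  have "D c = D a"
  proof (rule eq_if_increments_negligible[where a=a and b=c and D=D and M=M])
    fix \<epsilon> :: real assume "\<epsilon> > 0"
    have "uniformly_continuous_on {a..c} F" "uniformly_continuous_on {a..c} G"
      using cF cG by (auto intro: compact_uniformly_continuous)
    then obtain d1 d2 where "d1 > 0" "d2 > 0"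
      and d1: "\<And>u v. u \<in> {a..c} \<Longrightarrow> v \<in> {a..c} \<Longrightarrow> dist u v < d1 \<Longrightarrow> dist (F u) (F v) < \<epsilon>"
      and d2: "\<And>u v. u \<in> {a..c} \<Longrightarrow> v \<in> {a..c} \<Longrightarrow> dist u v < d2 \<Longrightarrow> dist (G u) (G v) < \<epsilon>"
      using \<open>\<epsilon> > 0\<close> unfolding uniformly_continuous_on_def by metis
    have "norm (D t - D s) \<le> \<epsilon> * (M t - M s)"
      if st: "a \<le> s" "s \<le> t" "t \<le> c" "t - s < min d1 d2" for s t
    proof -
      have sub: "{s..t} \<subseteq> {a..c}" using st by auto
      have split: "(LINT u:{a..t}|lborel. h u) = (LINT u:{a..s}|lborel. h u) + (LINT u:{s..t}|lborel. h u)"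
        if "set_integrable lborel {a..c} h" for h :: "real \<Rightarrow> 'b::euclidean_space"
        by (rule set_integral_split_Icc) (use st in \<open>auto intro: set_integrable_subset[OF that]\<close>)
      have fst: "set_integrable lborel {s..t} f" and gst: "set_integrable lborel {s..t} g"
        using f g sub by (auto intro: set_integrable_subset)
      have cFst: "continuous_on {s..t} F" and cGst: "continuous_on {s..t} G"
        using cF cG sub by (auto intro: continuous_on_subset)
      have Ft: "F t - F s = (LINT u:{s..t}|lborel. f u)" and Gt: "G t - G s = (LINT u:{s..t}|lborel. g u)"
        using F[of s] F[of t] G[of s] G[of t] st unfolding split[OF f] split[OF g] by auto
      have "D t - D s = G t * (F t - F s) + F s * (G t - G s) - (LINT u:{s..t}|lborel. k u)"
        by (simp add: D_def split[OF k] algebra_simps)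
      also have "\<dots> = (LINT u:{s..t}|lborel. (G t - G u) * f u) + (LINT u:{s..t}|lborel. (F s - F u) * g u)"
        unfolding Ft Gt k_def
        by (simp add: left_diff_distrib set_integrable_continuous_mult fst gst cFst cGst)
      finally have "norm (D t - D s) \<le> norm (LINT u:{s..t}|lborel. (G t - G u) * f u)
          + norm (LINT u:{s..t}|lborel. (F s - F u) * g u)"
        by (simp add: norm_triangle_ineq)
      also have "norm (LINT u:{s..t}|lborel. (G t - G u) * f u) \<le> \<epsilon> * (LINT u:{s..t}|lborel. norm (f u))"
        using st d2[of t] fst cGst
        by (intro norm_set_integral_mult_le continuous_intros)
           (auto simp: dist_norm intro!: less_imp_le)
      also have "norm (LINT u:{s..t}|lborel. (F s - F u) * g u) \<le> \<epsilon> * (LINT u:{s..t}|lborel. norm (g u))"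
        using st d1[of s] gst cFst
        by (intro norm_set_integral_mult_le continuous_intros)
           (auto simp: dist_norm intro!: less_imp_le)
      finally show ?thesis
        unfolding M_def split[OF nf] split[OF ng] by (simp add: algebra_simps)
    qed
    then show "\<exists>\<delta>>0. \<forall>s t. a \<le> s \<and> s \<le> t \<and> t \<le> c \<and> t - s < \<delta> \<longrightarrow> norm (D t - D s) \<le> \<epsilon> * (M t - M s)"
      using \<open>d1 > 0\<close> \<open>d2 > 0\<close> by (intro exI[of _ "min d1 d2"]) auto
  qed (fact)
  moreover have "(LINT u:{a..a}|lborel. k u) = 0"
    using set_borel_integral_eq_integral(2)[of "{a..a}" k, OF set_integrable_subset[OF k]] \<open>a \<le> c\<close>
    by simp
  ultimately show ?thesis
    by (simp add: D_def k_def algebra_simps)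
qed

lemma ln_eq_set_integral_log_derivative:
  fixes F f :: "real \<Rightarrow> real"
  assumes "a \<le> c"
    and f: "set_integrable lborel {a..c} f"
    and F: "\<And>x. x \<in> {a..c} \<Longrightarrow> F x = F a + (LINT u:{a..x}|lborel. f u)"
    and pos: "\<And>x. x \<in> {a..c} \<Longrightarrow> F x > 0"
  shows "ln (F c) = ln (F a) + (LINT u:{a..c}|lborel. inverse (F u) * f u)"
proof -
  have cF: "continuous_on {a..c} F"
    by (rule continuous_on_eq[where f="\<lambda>x. F a + (LINT u:{a..x}|lborel. f u)"])
       (intro continuous_intros continuous_on_set_integral_Icc[OF f], rule F[symmetric])
  have ci: "continuous_on {a..c} (\<lambda>u. inverse (F u))"
    using cF pos by (intro continuous_intros) force+
  define k where "k u = inverse (F u) * f u" for u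
  have k: "set_integrable lborel {a..c} k"
    unfolding k_def using ci f by (rule set_integrable_continuous_mult)
  have nf: "set_integrable lborel {a..c} (\<lambda>u. norm (f u))"
    using set_integrable_abs[OF f] by simp
  define D where "D x = ln (F x) - (LINT u:{a..x}|lborel. k u)" for x
  define M where "M x = (LINT u:{a..x}|lborel. norm (f u))" for x
  have "D c = D a"
  proof (rule eq_if_increments_negligible[where a=a and b=c and D=D and M=M])
    fix \<epsilon> :: real assume "\<epsilon> > 0"
    have "uniformly_continuous_on {a..c} (\<lambda>u. inverse (F u))"
      using ci by (auto intro: compact_uniformly_continuous)
    then obtain d where "d > 0"
      and d: "\<And>u v. u \<in> {a..c} \<Longrightarrow> v \<in> {a..c} \<Longrightarrow> dist u v < d \<Longrightarrow> dist (inverse (F u)) (inverse (F v)) < \<epsilon>"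
      using \<open>\<epsilon> > 0\<close> unfolding uniformly_continuous_on_def by metis
    have "norm (D t - D s) \<le> \<epsilon> * (M t - M s)"
      if st: "a \<le> s" "s \<le> t" "t \<le> c" "t - s < d" for s t
    proof -
      have sub: "{s..t} \<subseteq> {a..c}" using st by auto
      have split: "(LINT u:{a..t}|lborel. h u) = (LINT u:{a..s}|lborel. h u) + (LINT u:{s..t}|lborel. h u)"
        if "set_integrable lborel {a..c} h" for h :: "real \<Rightarrow> real"
        by (rule set_integral_split_Icc) (use st in \<open>auto intro: set_integrable_subset[OF that]\<close>)
      have fst: "set_integrable lborel {s..t} f"
        using f sub by (auto intro: set_integrable_subset)
      have cst: "continuous_on {s..t} F" "continuous_on {s..t} (\<lambda>u. inverse (F u))"
        using cF ci sub by (auto intro: continuous_on_subset)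
      have Ft: "F t - F s = (LINT u:{s..t}|lborel. f u)"
        using F[of s] F[of t] st unfolding split[OF f] by auto
      \<comment> \<open>\<open>F\<close> need not be differentiable, so the mean value theorem is
        applied to ln between the values F s and F t. The image of [s,t] is connected, so the
        intermediate value is attained as F v, where uniform continuity of 1 / F can be
        used.\<close>
      obtain v where v: "v \<in> {s..t}" "ln (F t) - ln (F s) = inverse (F v) * (F t - F s)"
      proof -
        have seg: "closed_segment (F s) (F t) \<subseteq> F ` {s..t}"
          using connected_contains_Icc[of "F ` {s..t}" "F s" "F t"]
                connected_contains_Icc[of "F ` {s..t}" "F t" "F s"]
                connected_continuous_image[OF cst(1)] st
          by (auto simp: closed_segment_eq_real_ivl)
        have "\<exists>w\<in>closed_segment (F s) (F t). ln (F t) - ln (F s) = inverse w * (F t - F s)"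
        proof -
          have dl: "(ln has_real_derivative inverse w) (at w)" if "w > 0" for w :: real
            using that by (auto intro!: derivative_eq_intros simp: field_simps)
          consider "F s = F t" | "F s < F t" | "F t < F s" by linarith
          then show ?thesis
          proof cases
            case 1
            then show ?thesis by auto
          next
            case 2
            then have "\<exists>w>F s. w < F t \<and> ln (F t) - ln (F s) = (F t - F s) * inverse w"
              using pos[of s] st by (intro MVT2 dl) auto
            then show ?thesis by (auto simp: closed_segment_eq_real_ivl mult.commute)
          next
            case 3
            then have "\<exists>w>F t. w < F s \<and> ln (F s) - ln (F t) = (F s - F t) * inverse w"
              using pos[of t] st by (intro MVT2 dl) auto
            then obtain w where "F t < w" "w < F s" "ln (F s) - ln (F t) = (F s - F t) * inverse w" by blast
            then show ?thesis using 3
              by (intro bexI[of _ w]) (auto simp: closed_segment_eq_real_ivl algebra_simps)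
          qed
        qed
        with seg show ?thesis using that by blast
      qed
      have "D t - D s = inverse (F v) * (F t - F s) - (LINT u:{s..t}|lborel. k u)"
        using v(2) by (simp add: D_def split[OF k] algebra_simps)
      also have "\<dots> = (LINT u:{s..t}|lborel. (inverse (F v) - inverse (F u)) * f u)"
        unfolding Ft k_def
        by (simp add: left_diff_distrib set_integrable_continuous_mult fst cst)
      finally have "norm (D t - D s) = norm (LINT u:{s..t}|lborel. (inverse (F v) - inverse (F u)) * f u)"
        by simp
      also have "\<dots> \<le> \<epsilon> * (LINT u:{s..t}|lborel. norm (f u))"
      proof (intro norm_set_integral_mult_le continuous_on_diff continuous_on_const cst fst)
        fix u assume u: "u \<in> {s..t}"
        have "dist v u < d" using u v st by (auto simp: dist_real_def)
        then show "norm (inverse (F v) - inverse (F u)) \<le> \<epsilon>"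
          using d[of v u] u v sub by (auto simp: dist_norm)
      qed
      finally show ?thesis
        unfolding M_def split[OF nf] by (simp add: algebra_simps)
    qed
    then show "\<exists>\<delta>>0. \<forall>s t. a \<le> s \<and> s \<le> t \<and> t \<le> c \<and> t - s < \<delta> \<longrightarrow> norm (D t - D s) \<le> \<epsilon> * (M t - M s)"
      using \<open>d > 0\<close> by (intro exI[of _ d]) auto
  qed (fact)
  moreover have "(LINT u:{a..a}|lborel. k u) = 0"
    using set_borel_integral_eq_integral(2)[of "{a..a}" k, OF set_integrable_subset[OF k]] \<open>a \<le> c\<close>
    by simp
  ultimately show ?thesis
    by (simp add: D_def k_def algebra_simps)
qed

section \<open>Real part, imaginary part and conjugate of set integrals\<close>

lemma set_integral_Re:
  assumes "set_integrable M S f"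
  shows "set_integrable M S (\<lambda>u. Re (f u))" "(LINT u:S|M. Re (f u)) = Re (LINT u:S|M. f u)"
  using integrable_Re[OF assms[unfolded set_integrable_def]] integral_Re[OF assms[unfolded set_integrable_def]]
  by (simp_all add: set_integrable_def set_lebesgue_integral_def)

lemma set_integral_Im:
  assumes "set_integrable M S f"
  shows "set_integrable M S (\<lambda>u. Im (f u))" "(LINT u:S|M. Im (f u)) = Im (LINT u:S|M. f u)"
  using integrable_Im[OF assms[unfolded set_integrable_def]] integral_Im[OF assms[unfolded set_integrable_def]]
  by (simp_all add: set_integrable_def set_lebesgue_integral_def)

lemma set_integral_cnj:
  assumes "set_integrable M S f"
  shows "set_integrable M S (\<lambda>u. cnj (f u))" "(LINT u:S|M. cnj (f u)) = cnj (LINT u:S|M. f u)"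
proof -
  have e: "(\<lambda>u. indicator S u *\<^sub>R cnj (f u)) = (\<lambda>u. cnj (indicator S u *\<^sub>R f u))"
    by (auto simp: fun_eq_iff)
  show "set_integrable M S (\<lambda>u. cnj (f u))"
    using assms unfolding set_integrable_def e by (simp only: complex_integrable_cnj)
  show "(LINT u:S|M. cnj (f u)) = cnj (LINT u:S|M. f u)"
    unfolding set_lebesgue_integral_def e
    by (rule integral_bounded_linear[OF bounded_linear_cnj assms[unfolded set_integrable_def]])
qed

lemma set_integrable_zero: "set_integrable M S (\<lambda>_. 0 :: real)"
  by (simp add: set_integrable_def)

section \<open>Positive semidefinite forms on the plane\<close>

text \<open>The off-diagonal entry comes last, as in h1, h2, h3; the body is the positivity clause
  of \<open>hamiltonian\<close>.\<close>

definition psd2 :: "real \<Rightarrow> real \<Rightarrow> real \<Rightarrow> bool" where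
  "psd2 x1 x2 x3 \<longleftrightarrow> (\<forall>u v. x1 * u\<^sup>2 + 2 * x3 * u * v + x2 * v\<^sup>2 \<ge> 0)"

text \<open>The Hermitian form y X y^* of the row y = (p, q), for the real symmetric matrix X with
  these entries.\<close>

definition hform :: "real \<Rightarrow> real \<Rightarrow> real \<Rightarrow> complex \<Rightarrow> complex \<Rightarrow> real" where
  "hform x1 x2 x3 p q = x1 * (cmod p)\<^sup>2 + 2 * x3 * Re (p * cnj q) + x2 * (cmod q)\<^sup>2"

lemma psd2D:
  assumes "psd2 x1 x2 x3"
  shows "x1 \<ge> 0" "x2 \<ge> 0" "x3\<^sup>2 \<le> x1 * x2"
proof -
  have q: "x1 * u\<^sup>2 + 2 * x3 * u * v + x2 * v\<^sup>2 \<ge> 0" for u v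
    using assms by (simp add: psd2_def)
  show 1: "x1 \<ge> 0" "x2 \<ge> 0"
    using q[of 1 0] q[of 0 1] by auto
  show "x3\<^sup>2 \<le> x1 * x2"
  proof (cases "x1 = 0")
    case True
    have "x3 = 0"
    proof (rule ccontr)
      assume "x3 \<noteq> 0"
      \<comment> \<open>With v = 1 this u makes the mixed term -(x2 + 1), so the form takes the
        value -1.\<close>
      then show False
        using q[of "- (x2 + 1) / (2 * x3)" 1] True by simp
    qed
    then show ?thesis using True by simp
  next
    case False
    \<comment> \<open>At the vector (-x3, x1) the form equals x1 times the determinant.\<close>
    have "x1 * (x1 * x2 - x3\<^sup>2) \<ge> 0"
      using q[of "-x3" x1] by (simp add: power2_eq_square algebra_simps)
    then show ?thesis
      using False 1 by (simp add: zero_le_mult_iff)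
  qed
qed

text \<open>Rotating the argument by a right angle turns the form of a 2x2 matrix into that of its
  adjugate.\<close>

lemma psd2_adjugate:
  assumes "psd2 x1 x2 x3"
  shows "psd2 x2 x1 (- x3)"
  unfolding psd2_def
proof (intro allI)
  fix u v :: real
  show "0 \<le> x2 * u\<^sup>2 + 2 * - x3 * u * v + x1 * v\<^sup>2"
    using assms[unfolded psd2_def, rule_format, of "- v" u] by (simp add: algebra_simps)
qed

text \<open>This is tr(XP). By the two determinant conditions and the inequality of arithmetic and
  geometric means, the mixed term cannot outweigh the diagonal ones.\<close>

lemma psd2_trace_mult_nonneg:
  assumes "psd2 x1 x2 x3" "psd2 p1 p2 p3"
  shows "x1 * p1 + 2 * (x3 * p3) + x2 * p2 \<ge> 0"
proof -
  note x = psd2D[OF assms(1)] and p = psd2D[OF assms(2)]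
  have "(x3 * p3)\<^sup>2 \<le> (x1 * x2) * (p1 * p2)"
    unfolding power_mult_distrib using x p by (intro mult_mono) auto
  also have "4 * ((x1 * x2) * (p1 * p2)) \<le> (x1 * p1 + x2 * p2)\<^sup>2"
    using zero_le_power2[of "x1 * p1 - x2 * p2"] by (simp add: power2_eq_square algebra_simps)
  finally have "\<bar>2 * (x3 * p3)\<bar>\<^sup>2 \<le> (x1 * p1 + x2 * p2)\<^sup>2"
    by (simp add: power_mult_distrib)
  then have "\<bar>2 * (x3 * p3)\<bar> \<le> x1 * p1 + x2 * p2"
    by (rule power2_le_imp_le) (use x p in auto)
  then show ?thesis by linarith
qed

lemma hform_Re_Im:
  "hform x1 x2 x3 p q = (x1 * (Re p)\<^sup>2 + 2 * x3 * Re p * Re q + x2 * (Re q)\<^sup>2)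
     + (x1 * (Im p)\<^sup>2 + 2 * x3 * Im p * Im q + x2 * (Im q)\<^sup>2)"
  by (simp add: hform_def cmod_power2 algebra_simps)

lemma hform_nonneg: "psd2 x1 x2 x3 \<Longrightarrow> hform x1 x2 x3 p q \<ge> 0"
  by (simp add: hform_Re_Im psd2_def)

text \<open>Parallelogram law, with the form of the sum dropped.\<close>

lemma hform_diff_le:
  assumes "psd2 x1 x2 x3"
  shows "hform x1 x2 x3 (p - p') (q - q') \<le> 2 * hform x1 x2 x3 p q + 2 * hform x1 x2 x3 p' q'"
proof -
  have "hform x1 x2 x3 (p - p') (q - q') + hform x1 x2 x3 (p + p') (q + q')
      = 2 * hform x1 x2 x3 p q + 2 * hform x1 x2 x3 p' q'"
    by (simp add: hform_Re_Im power2_eq_square algebra_simps)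
  then show ?thesis
    using hform_nonneg[OF assms, of "p + p'" "q + q'"] by linarith
qed

lemma hform_complete_square1:
  "x1 * hform x1 x2 x3 p q = (cmod (x1 * p + x3 * q))\<^sup>2 + (x1 * x2 - x3\<^sup>2) * (cmod q)\<^sup>2"
  unfolding hform_Re_Im cmod_power2 by (simp add: power2_eq_square algebra_simps)

lemma hform_complete_square2:
  "x2 * hform x1 x2 x3 p q = (cmod (x3 * p + x2 * q))\<^sup>2 + (x1 * x2 - x3\<^sup>2) * (cmod p)\<^sup>2"
  unfolding hform_Re_Im cmod_power2 by (simp add: power2_eq_square algebra_simps)

text \<open>The hypothesis is what positivity of the squared seminorm of y - l e provides, with N
  and S those of y and e and G the mixed term. Real multiples l = x G suffice.\<close>

lemma Cauchy_Schwarz_if_quadratic_nonneg: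
  fixes G :: complex and N S :: real
  assumes "\<And>l. 0 \<le> N - 2 * Re (cnj l * G) + (cmod l)\<^sup>2 * S" and "S \<ge> 0"
  shows "(cmod G)\<^sup>2 \<le> N * S"
proof -
  have *: "0 \<le> N - 2 * x * (cmod G)\<^sup>2 + x\<^sup>2 * (cmod G)\<^sup>2 * S" for x :: real
  proof -
    have "Re (cnj (x * G) * G) = x * (cmod G)\<^sup>2"
      by (simp add: cmod_power2) (simp add: power2_eq_square algebra_simps)
    moreover have "(cmod (x * G))\<^sup>2 = x\<^sup>2 * (cmod G)\<^sup>2"
      by (simp add: norm_mult power_mult_distrib)
    ultimately show ?thesis
      using assms(1)[of "x * G"] by simp
  qed
  show ?thesis
  proof (cases "S = 0")
    case True
    have "G = 0"
    proof (rule ccontr)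
      assume "G \<noteq> 0"
      then show False
        \<comment> \<open>For S = 0 this x makes the right-hand side equal to -1.\<close>
        using *[of "(N + 1) / (2 * (cmod G)\<^sup>2)"] True by (simp add: field_simps)
    qed
    then show ?thesis using True by simp
  next
    case False
    then have "S > 0" using assms(2) by simp
    then show ?thesis
      \<comment> \<open>x = 1 / S minimizes the quadratic.\<close>
      using *[of "1 / S"] by (simp add: field_simps power2_eq_square)
  qed
qed

section \<open>Comparison of Im (q * cnj p) with |q|^2\<close>

lemma power2_norm_add_le:
  fixes p q :: complex
  shows "(cmod (p + q))\<^sup>2 \<le> 2 * (cmod p)\<^sup>2 + 2 * (cmod q)\<^sup>2"
proof -
  have "(cmod (p + q))\<^sup>2 \<le> (cmod p + cmod q)\<^sup>2"
    by (intro power_mono norm_triangle_ineq) auto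
  also have "\<dots> \<le> 2 * (cmod p)\<^sup>2 + 2 * (cmod q)\<^sup>2"
    using zero_le_power2[of "cmod p - cmod q"] by (simp add: power2_eq_square algebra_simps)
  finally show ?thesis .
qed

text \<open>To be read with (p, q) = y(t) and X = \<Omega>(s,t). In the completed square, the
  determinant term bounds |q|^2, and the other term bounds x1 p + x3 q, through which E can be
  expressed. Both estimates need only r N \<le> E, so energy accumulated before s does no
  harm.\<close>

lemma Im_bounds_of_det_ge:
  fixes p q :: complex and r E N \<kappa> cm x1 x2 x3 :: real
  assumes r: "r > 0" and E: "E = Im (q * cnj p)" and N: "0 \<le> N" "r * N \<le> E"
    and h: "hform x1 x2 x3 p q \<le> \<kappa> * N" and x1: "x1 > 0"
    and \<kappa>: "\<kappa> \<ge> 0"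
    and det: "cm / r\<^sup>2 \<le> x1 * x2 - x3\<^sup>2" and cm: "cm > 0"
  shows "cm * (cmod q)\<^sup>2 \<le> \<kappa> * x1 * (r * E)" "x1 * (r * E) \<le> \<kappa> * (cmod q)\<^sup>2"
proof -
  have E0: "E \<ge> 0" using N r by (smt (verit) mult_nonneg_nonneg)
  have det0: "x1 * x2 - x3\<^sup>2 > 0" using det cm r by (smt (verit) divide_pos_pos zero_less_power)
  have sq: "(cmod (x1 * p + x3 * q))\<^sup>2 + (x1 * x2 - x3\<^sup>2) * (cmod q)\<^sup>2 \<le> x1 * (\<kappa> * N)"
    unfolding hform_complete_square1[symmetric] using h x1 by simp
  have "cm \<le> r\<^sup>2 * (x1 * x2 - x3\<^sup>2)" using det r by (simp add: field_simps)
  then have "cm * (cmod q)\<^sup>2 \<le> r\<^sup>2 * (x1 * x2 - x3\<^sup>2) * (cmod q)\<^sup>2"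
    by (intro mult_right_mono) auto
  also have "\<dots> = r\<^sup>2 * ((x1 * x2 - x3\<^sup>2) * (cmod q)\<^sup>2)" by simp
  also have "\<dots> \<le> r\<^sup>2 * (x1 * (\<kappa> * N))"
    using sq by (intro mult_left_mono) (smt (verit) zero_le_power2, simp)
  also have "\<dots> = (\<kappa> * x1 * r) * (r * N)" by (simp add: power2_eq_square)
  also have "\<dots> \<le> (\<kappa> * x1 * r) * E"
    using r x1 \<kappa> N by (intro mult_left_mono) auto
  finally show "cm * (cmod q)\<^sup>2 \<le> \<kappa> * x1 * (r * E)" by (simp add: mult_ac)
  show "x1 * (r * E) \<le> \<kappa> * (cmod q)\<^sup>2"
  \<comment> \<open>Squaring below leaves a factor x1 * E on both sides, which can be cancelled only
    for E > 0.\<close>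
  proof (cases "E = 0")
    case True
    then show ?thesis using \<kappa> by simp
  next
    case False
    then have Ep: "E > 0" using E0 by simp
    \<comment> \<open>Adding x3 q under the conjugate is free, since q * cnj q is real.\<close>
    have "x1 * E = Im (q * cnj (x1 * p + x3 * q))"
      by (simp add: E algebra_simps)
    also have "\<dots> \<le> cmod (q * cnj (x1 * p + x3 * q))"
      by (meson abs_Im_le_cmod abs_le_D1)
    also have "\<dots> = cmod q * cmod (x1 * p + x3 * q)"
      by (simp only: norm_mult complex_mod_cnj)
    finally have "(x1 * E)\<^sup>2 \<le> (cmod q * cmod (x1 * p + x3 * q))\<^sup>2"
      using x1 E0 by (intro power_mono) auto
    also have "\<dots> = (cmod q)\<^sup>2 * (cmod (x1 * p + x3 * q))\<^sup>2"
      by (simp add: power_mult_distrib)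
    also have "\<dots> \<le> (cmod q)\<^sup>2 * (x1 * (\<kappa> * N))"
      using sq det0 by (intro mult_left_mono) (smt (verit) mult_nonneg_nonneg zero_le_power2, simp)
    finally have "r * (x1 * E)\<^sup>2 \<le> r * ((cmod q)\<^sup>2 * (x1 * (\<kappa> * N)))"
      using r by (intro mult_left_mono) auto
    also have "\<dots> = ((cmod q)\<^sup>2 * x1 * \<kappa>) * (r * N)"
      by simp
    also have "\<dots> \<le> ((cmod q)\<^sup>2 * x1 * \<kappa>) * E"
      using x1 \<kappa> N by (intro mult_left_mono) auto
    finally have "(x1 * E) * (x1 * (r * E)) \<le> (x1 * E) * (\<kappa> * (cmod q)\<^sup>2)"
      by (simp add: power2_eq_square mult_ac)
    then show ?thesis
      using x1 Ep by simp
  qed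
qed

text \<open>The determinant may be arbitrarily small here, so |p|^2 is controlled by the hypothesis
  \<open>p\<close>, which comes from y1(a) = 0. With s = x3 p + x2 q, both |s|^2 and |p|^2 / r^2 are
  bounded by multiples of N x2, and r N = E converts between energy and E.\<close>

lemma Im_bounds_of_zero_start:
  fixes p q :: complex and r E N \<kappa> x1 x2 x3 :: real
  assumes r: "r > 0" and E: "E = Im (q * cnj p)" and N: "0 \<le> N" "r * N = E"
    and h: "hform x1 x2 x3 p q \<le> \<kappa> * N" and psd: "psd2 x1 x2 x3" and \<kappa>: "\<kappa> \<ge> 0"
    and p: "(cmod p)\<^sup>2 \<le> r\<^sup>2 * (N * x2)"
  shows "x2 * (cmod q)\<^sup>2 \<le> 2 * (\<kappa> / r\<^sup>2 + x3\<^sup>2) * (r * E)"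
    and "(1 / r\<^sup>2 + x3\<^sup>2) * (r * E) \<le> \<kappa> * (3 + 2 * \<kappa>) * (x2 * (cmod q)\<^sup>2)"
proof -
  note x = psd2D[OF psd]
  define s where "s = x3 * p + x2 * q"
  have E0: "E \<ge> 0" using N r by (metis mult_nonneg_nonneg less_imp_le)
  have "(cmod s)\<^sup>2 + (x1 * x2 - x3\<^sup>2) * (cmod p)\<^sup>2 \<le> x2 * (\<kappa> * N)"
    unfolding s_def hform_complete_square2[symmetric] using h x by (intro mult_left_mono)
  moreover have "(x1 * x2 - x3\<^sup>2) * (cmod p)\<^sup>2 \<ge> 0" using x by simp
  ultimately have s: "(cmod s)\<^sup>2 \<le> \<kappa> * (N * x2)" by (simp add: mult_ac)
  have rE: "r * E = r\<^sup>2 * N" using N by (simp add: power2_eq_square)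
  have xs: "(cmod (x3 * p))\<^sup>2 = x3\<^sup>2 * (cmod p)\<^sup>2" "(cmod (x2 * q))\<^sup>2 = x2\<^sup>2 * (cmod q)\<^sup>2"
    by (simp_all add: norm_mult power_mult_distrib)
  consider "x2 = 0" | "x2 > 0" using x by linarith
  then have "x2 * (cmod q)\<^sup>2 \<le> 2 * (\<kappa> / r\<^sup>2 + x3\<^sup>2) * (r * E) \<and>
    (1 / r\<^sup>2 + x3\<^sup>2) * (r * E) \<le> \<kappa> * (3 + 2 * \<kappa>) * (x2 * (cmod q)\<^sup>2)"
  proof cases
    case 1
    \<comment> \<open>Then E = 0 as well, and all four sides vanish.\<close>
    then have "p = 0" using p by simp
    then show ?thesis using 1 E by simp
  next
    case 2
    \<comment> \<open>Uses x2 q = s - x3 p; the surplus factor x2 is divided out afterwards.\<close>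
    have "(cmod (x2 * q))\<^sup>2 \<le> 2 * (cmod s)\<^sup>2 + 2 * (cmod (- (x3 * p)))\<^sup>2"
      using power2_norm_add_le[of s "- (x3 * p)"] by (simp add: s_def)
    also have "\<dots> \<le> 2 * (\<kappa> * (N * x2)) + 2 * (x3\<^sup>2 * (r\<^sup>2 * (N * x2)))"
      unfolding norm_minus_cancel xs using s p by (intro add_mono mult_left_mono) auto
    finally have "x2 * (x2 * (cmod q)\<^sup>2) \<le> x2 * (2 * (\<kappa> + r\<^sup>2 * x3\<^sup>2) * N)"
      unfolding xs by (simp add: power2_eq_square algebra_simps)
    then have "x2 * (cmod q)\<^sup>2 \<le> 2 * (\<kappa> + r\<^sup>2 * x3\<^sup>2) * N"
      using 2 by simp
    also have "\<dots> = 2 * (\<kappa> / r\<^sup>2 + x3\<^sup>2) * (r * E)"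
      unfolding rE using r by (simp add: field_simps)
    finally have lower: "x2 * (cmod q)\<^sup>2 \<le> 2 * (\<kappa> / r\<^sup>2 + x3\<^sup>2) * (r * E)" .
    have EA: "E \<le> cmod q * cmod p"
      unfolding E by (metis abs_Im_le_cmod abs_le_D1 complex_mod_cnj norm_mult)
    \<comment> \<open>Inserting E \<le> |q| |p| leaves a factor |p| on both sides; cancelling it
      gives |p| \<le> r x2 |q|, so p is controlled by q.\<close>
    have pE: "(cmod p)\<^sup>2 \<le> x2 * (r * E)" using p rE by (simp add: mult_ac)
    also have "\<dots> \<le> x2 * (r * (cmod q * cmod p))"
      using EA r 2 by (intro mult_left_mono) auto
    finally have "cmod p * cmod p \<le> (r * x2 * cmod q) * cmod p"
      by (simp add: power2_eq_square mult_ac)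
    then have pq: "cmod p \<le> r * x2 * cmod q"
      using r 2 by (cases "p = 0") auto
    have "x2 * (r * E) \<le> x2 * (r * (cmod q * cmod p))"
      using EA r 2 by (intro mult_left_mono) auto
    also have "\<dots> \<le> x2 * (r * (cmod q * (r * x2 * cmod q)))"
      using pq r 2 by (intro mult_left_mono) auto
    finally have "r\<^sup>2 * (N * x2) \<le> r\<^sup>2 * (x2\<^sup>2 * (cmod q)\<^sup>2)"
      unfolding rE by (simp add: power2_eq_square mult_ac)
    then have T: "N * x2 \<le> x2\<^sup>2 * (cmod q)\<^sup>2"
      using r by simp
    have "(cmod (x3 * p))\<^sup>2 \<le> 2 * (cmod s)\<^sup>2 + 2 * (cmod (- (x2 * q)))\<^sup>2"
      using power2_norm_add_le[of s "- (x2 * q)"] by (simp add: s_def)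
    also have "\<dots> \<le> 2 * (\<kappa> * (x2\<^sup>2 * (cmod q)\<^sup>2)) + 2 * (x2\<^sup>2 * (cmod q)\<^sup>2)"
      unfolding norm_minus_cancel xs using s mult_left_mono[OF T \<kappa>] by (intro add_mono mult_left_mono) auto
    finally have 3: "x3\<^sup>2 * (cmod p)\<^sup>2 \<le> 2 * (\<kappa> + 1) * (x2\<^sup>2 * (cmod q)\<^sup>2)"
      unfolding xs by (simp add: algebra_simps)
    have "(cmod p)\<^sup>2 / r\<^sup>2 \<le> N * x2"
      using p r by (simp add: field_simps)
    \<comment> \<open>Origin of 3 + 2 * \<kappa>: 1 comes from \<open>T\<close>, and 2 * (\<kappa> +
      1) from x3 p = s - x2 q.\<close>
    then have 4: "(1 / r\<^sup>2 + x3\<^sup>2) * (cmod p)\<^sup>2 \<le> (3 + 2 * \<kappa>) * (x2\<^sup>2 * (cmod q)\<^sup>2)"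
      using 3 T by (simp add: algebra_simps)
    have 5: "x2 * (r * E) \<le> \<kappa> * (cmod p)\<^sup>2"
    proof (cases "E = 0")
      case True
      then show ?thesis using \<kappa> by simp
    next
      case False
      then have Ep: "E > 0" using E0 by simp
      \<comment> \<open>The part x3 p of s contributes only the real number x3 |p|^2.\<close>
      have "x2 * E = Im (s * cnj p)"
        by (simp add: E s_def algebra_simps)
      also have "\<dots> \<le> cmod (s * cnj p)"
        by (meson abs_Im_le_cmod abs_le_D1)
      also have "\<dots> = cmod s * cmod p"
        by (simp only: norm_mult complex_mod_cnj)
      finally have "(x2 * E)\<^sup>2 \<le> (cmod s * cmod p)\<^sup>2"
        using 2 E0 by (intro power_mono) auto
      also have "\<dots> = (cmod s)\<^sup>2 * (cmod p)\<^sup>2"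
        by (simp add: power_mult_distrib)
      also have "\<dots> \<le> (\<kappa> * (N * x2)) * (cmod p)\<^sup>2"
        using s by (intro mult_right_mono) auto
      finally have "r * (x2 * E)\<^sup>2 \<le> r * ((\<kappa> * (N * x2)) * (cmod p)\<^sup>2)"
        using r by (intro mult_left_mono) auto
      also have "\<dots> = (r * N) * (\<kappa> * x2 * (cmod p)\<^sup>2)"
        by simp
      finally have "(x2 * E) * (x2 * (r * E)) \<le> (x2 * E) * (\<kappa> * (cmod p)\<^sup>2)"
        unfolding N by (simp add: power2_eq_square mult_ac)
      then show ?thesis
        using 2 Ep by simp
    qed
    have "x2 * ((1 / r\<^sup>2 + x3\<^sup>2) * (r * E)) = (1 / r\<^sup>2 + x3\<^sup>2) * (x2 * (r * E))"
      by simp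
    also have "\<dots> \<le> (1 / r\<^sup>2 + x3\<^sup>2) * (\<kappa> * (cmod p)\<^sup>2)"
      using 5 by (intro mult_left_mono) auto
    also have "\<dots> = \<kappa> * ((1 / r\<^sup>2 + x3\<^sup>2) * (cmod p)\<^sup>2)" by simp
    also have "\<dots> \<le> \<kappa> * ((3 + 2 * \<kappa>) * (x2\<^sup>2 * (cmod q)\<^sup>2))"
      using 4 \<kappa> by (intro mult_left_mono)
    also have "\<dots> = x2 * (\<kappa> * (3 + 2 * \<kappa>) * (x2 * (cmod q)\<^sup>2))"
      by (simp add: power2_eq_square)
    finally have "(1 / r\<^sup>2 + x3\<^sup>2) * (r * E) \<le> \<kappa> * (3 + 2 * \<kappa>) * (x2 * (cmod q)\<^sup>2)"
      using 2 by simp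
    with lower show ?thesis by blast
  qed
  then show "x2 * (cmod q)\<^sup>2 \<le> 2 * (\<kappa> / r\<^sup>2 + x3\<^sup>2) * (r * E)"
    and "(1 / r\<^sup>2 + x3\<^sup>2) * (r * E) \<le> \<kappa> * (3 + 2 * \<kappa>) * (x2 * (cmod q)\<^sup>2)" by blast+
qed

section \<open>The lower row of the fundamental solution\<close>

text \<open>The functions y1 and y2 form the lower row of the fundamental solution at the spectral
  parameter z = ir.\<close>

locale canonical_row =
  fixes a c r :: real and h1 h2 h3 :: "real \<Rightarrow> real" and y1 y2 :: "real \<Rightarrow> complex"
  assumes ac: "a \<le> c" and r: "r > 0"
    and h: "set_integrable lborel {a..c} h1" "set_integrable lborel {a..c} h2"
           "set_integrable lborel {a..c} h3"
    and psd: "AE u in lborel. u \<in> {a..c} \<longrightarrow> psd2 (h1 u) (h2 u) (h3 u)"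
    and cont: "continuous_on {a..c} y1" "continuous_on {a..c} y2"
    and y1: "\<And>x. x \<in> {a..c} \<Longrightarrow> y1 x = - (\<i> * r) * (LINT u:{a..x}|lborel. y1 u * h3 u + y2 u * h2 u)"
    and y2: "\<And>x. x \<in> {a..c} \<Longrightarrow> y2 x = 1 + (\<i> * r) * (LINT u:{a..x}|lborel. y1 u * h1 u + y2 u * h3 u)"
begin

text \<open>\<open>g1\<close> and \<open>g2\<close> are the entries of the row \<integral> yH. The
  matrix J interchanges them, so \<open>g2\<close> drives y1 and \<open>g1\<close> drives y2.
  \<open>energy\<close> is the N of the overview.\<close>

definition "g1 s t = (LINT u:{s..t}|lborel. y1 u * h1 u + y2 u * h3 u)"
definition "g2 s t = (LINT u:{s..t}|lborel. y1 u * h3 u + y2 u * h2 u)"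
definition "energy s t = (LINT u:{s..t}|lborel. hform (h1 u) (h2 u) (h3 u) (y1 u) (y2 u))"

lemma h_sub: "a \<le> s \<Longrightarrow> t \<le> c \<Longrightarrow> set_integrable lborel {s..t} h1"
  "a \<le> s \<Longrightarrow> t \<le> c \<Longrightarrow> set_integrable lborel {s..t} h2"
  "a \<le> s \<Longrightarrow> t \<le> c \<Longrightarrow> set_integrable lborel {s..t} h3"
  by (auto intro: set_integrable_subset[OF h(1)] set_integrable_subset[OF h(2)] set_integrable_subset[OF h(3)])

lemma cont_sub: "a \<le> s \<Longrightarrow> t \<le> c \<Longrightarrow> continuous_on {s..t} y1"
  "a \<le> s \<Longrightarrow> t \<le> c \<Longrightarrow> continuous_on {s..t} y2"
  by (auto intro: continuous_on_subset[OF cont(1)] continuous_on_subset[OF cont(2)])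

lemma psd_sub:
  assumes "a \<le> s" "t \<le> c"
  shows "AE u in lborel. u \<in> {s..t} \<longrightarrow> psd2 (h1 u) (h2 u) (h3 u)"
  using psd by eventually_elim (use assms in auto)

lemma cmult_integrable:
  fixes s t :: real
  assumes "set_integrable lborel {s..t} k" "continuous_on {s..t} \<phi>"
  shows "set_integrable lborel {s..t} (\<lambda>u. \<phi> u * complex_of_real (k u))"
proof (rule set_integrable_continuous_mult[OF assms(2)])
  have "(\<lambda>u. indicator {s..t} u *\<^sub>R complex_of_real (k u)) = (\<lambda>u. complex_of_real (indicator {s..t} u *\<^sub>R k u))"
    by (auto simp: fun_eq_iff scaleR_conv_of_real)
  then show "set_integrable lborel {s..t} (\<lambda>u. complex_of_real (k u))"
    using assms(1) by (simp add: set_integrable_def complex_of_real_integrable_eq del: of_real_mult real_scaleR_def)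
qed

lemma g_integrable:
  assumes "a \<le> s" "t \<le> c"
  shows "set_integrable lborel {s..t} (\<lambda>u. y1 u * h1 u + y2 u * h3 u)"
    "set_integrable lborel {s..t} (\<lambda>u. y1 u * h3 u + y2 u * h2 u)"
  using assms by (auto intro!: set_integral_add cmult_integrable h_sub cont_sub)

text \<open>The row (p, q) is kept free because the constant row y(t) and the shifted rows y - l
  (\<alpha>, \<beta>) are inserted as well as y.\<close>

lemma hform_integrable:
  assumes "a \<le> s" "t \<le> c" "continuous_on {s..t} p" "continuous_on {s..t} q"
  shows "set_integrable lborel {s..t} (\<lambda>u. hform (h1 u) (h2 u) (h3 u) (p u) (q u))"
proof -
  have "set_integrable lborel {s..t} (\<lambda>u. (cmod (p u))\<^sup>2 * h1 u + 2 * Re (p u * cnj (q u)) * h3 u + (cmod (q u))\<^sup>2 * h2 u)"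
    using assms by (intro set_integral_add set_integrable_continuous_mult h_sub continuous_intros) auto
  then show ?thesis
    by (simp add: hform_def mult_ac)
qed

section \<open>The matrices \<Omega>(s,t) and the energy on subintervals\<close>

lemma omega_split:
  assumes "a \<le> s" "s \<le> u" "u \<le> t" "t \<le> c"
  shows "omega h1 s t = omega h1 s u + omega h1 u t" "omega h2 s t = omega h2 s u + omega h2 u t"
    "omega h3 s t = omega h3 s u + omega h3 u t"
  unfolding omega_def using assms by (auto intro!: set_integral_split_Icc h_sub)

lemma omega_psd:
  assumes "a \<le> s" "t \<le> c"
  shows "psd2 (omega h1 s t) (omega h2 s t) (omega h3 s t)"
  unfolding psd2_def
proof (intro allI)
  fix \<alpha> \<beta> :: real
  have "0 = (LINT u:{s..t}|lborel. 0::real)" by simp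
  also have "\<dots> \<le> (LINT u:{s..t}|lborel. h1 u * \<alpha>\<^sup>2 + 2 * \<alpha> * \<beta> * h3 u + h2 u * \<beta>\<^sup>2)"
  proof (rule set_integral_mono_AE)
    show "AE u\<in>{s..t} in lborel. 0 \<le> h1 u * \<alpha>\<^sup>2 + 2 * \<alpha> * \<beta> * h3 u + h2 u * \<beta>\<^sup>2"
      using psd_sub[OF assms] by eventually_elim (auto simp: psd2_def mult_ac)
  qed (use h_sub[OF assms] in \<open>auto intro!: set_integral_add set_integrable_zero\<close>)
  also have "\<dots> = omega h1 s t * \<alpha>\<^sup>2 + 2 * omega h3 s t * \<alpha> * \<beta> + omega h2 s t * \<beta>\<^sup>2"
    by (simp add: omega_def h_sub[OF assms])
  finally show "0 \<le> omega h1 s t * \<alpha>\<^sup>2 + 2 * omega h3 s t * \<alpha> * \<beta> + omega h2 s t * \<beta>\<^sup>2" .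
qed

text \<open>det (P + Q) = det P + tr (adj P Q) + det Q, and the last two terms are nonnegative. This
  carries the upper bound at \<open>that r\<close> back to all earlier t.\<close>

lemma detOmega_mono:
  assumes "a \<le> s" "s \<le> u" "u \<le> t" "t \<le> c"
  shows "detOmega h1 h2 h3 s u \<le> detOmega h1 h2 h3 s t"
proof -
  have P: "psd2 (omega h1 s u) (omega h2 s u) (omega h3 s u)"
    and Q: "psd2 (omega h1 u t) (omega h2 u t) (omega h3 u t)"
    using assms by (auto intro!: omega_psd)
  from psd2_trace_mult_nonneg[OF psd2_adjugate[OF P] Q] psd2D(3)[OF Q]
  show ?thesis
    unfolding detOmega_def omega_split[OF assms] by (simp add: power2_eq_square algebra_simps)
qed

lemma energy_nonneg:
  assumes "a \<le> s" "t \<le> c"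
  shows "0 \<le> energy s t"
proof -
  have "0 = (LINT u:{s..t}|lborel. 0::real)" by simp
  also have "\<dots> \<le> energy s t"
    unfolding energy_def
  proof (rule set_integral_mono_AE)
    show "AE u\<in>{s..t} in lborel. 0 \<le> hform (h1 u) (h2 u) (h3 u) (y1 u) (y2 u)"
      using psd_sub[OF assms] by eventually_elim (auto intro: hform_nonneg)
  qed (use assms in \<open>auto intro!: hform_integrable cont_sub set_integrable_zero\<close>)
  finally show ?thesis .
qed

lemma energy_split:
  assumes "a \<le> s" "s \<le> u" "u \<le> t" "t \<le> c"
  shows "energy s t = energy s u + energy u t"
  unfolding energy_def using assms by (auto intro!: set_integral_split_Icc hform_integrable cont_sub)

lemma energy_mono: "a \<le> s \<Longrightarrow> s \<le> u \<Longrightarrow> u \<le> t \<Longrightarrow> t \<le> c \<Longrightarrow> energy u t \<le> energy s t"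
  using energy_split[of s u t] energy_nonneg[of s u] by simp

section \<open>Variation of the row over [s,t]\<close>

lemma y_step:
  assumes "a \<le> u" "u \<le> t" "t \<le> c"
  shows "y1 u = y1 t + (\<i> * r) * g2 u t" "y2 u = y2 t - (\<i> * r) * g1 u t"
proof -
  have "(LINT v:{a..t}|lborel. y1 v * h1 v + y2 v * h3 v)
      = (LINT v:{a..u}|lborel. y1 v * h1 v + y2 v * h3 v) + g1 u t"
    "(LINT v:{a..t}|lborel. y1 v * h3 v + y2 v * h2 v)
      = (LINT v:{a..u}|lborel. y1 v * h3 v + y2 v * h2 v) + g2 u t"
    unfolding g1_def g2_def using assms by (auto intro!: set_integral_split_Icc g_integrable)
  note split = this
  have u: "u \<in> {a..c}" and t: "t \<in> {a..c}" using assms by auto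
  show "y1 u = y1 t + (\<i> * r) * g2 u t"
    unfolding y1[OF u] y1[OF t] split by (simp add: algebra_simps)
  show "y2 u = y2 t - (\<i> * r) * g1 u t"
    unfolding y2[OF u] y2[OF t] split by (simp add: algebra_simps)
qed

text \<open>Cauchy-Schwarz for \<integral> y H e^T with e = (\<alpha>, \<beta>), in the seminorm of
  L^2(H). Both factors are enlarged from [u,t] to [s,t], so that one bound serves all u. Real e
  suffice: H is real, so only the real part of the Gram matrix of (g1, g2) enters later.\<close>

lemma g_Cauchy_Schwarz:
  assumes "a \<le> s" "s \<le> u" "u \<le> t" "t \<le> c"
  shows "(cmod (\<alpha> * g1 u t + \<beta> * g2 u t))\<^sup>2
    \<le> energy s t * (omega h1 s t * \<alpha>\<^sup>2 + 2 * omega h3 s t * \<alpha> * \<beta> + omega h2 s t * \<beta>\<^sup>2)"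
    (is "_ \<le> _ * ?S s t")
proof -
  have sub: "a \<le> u" "t \<le> c" using assms by auto
  define k where "k v = \<alpha> * (y1 v * h1 v + y2 v * h3 v) + \<beta> * (y1 v * h3 v + y2 v * h2 v)" for v
  have k: "set_integrable lborel {u..t} k"
    unfolding k_def using g_integrable[OF sub] by simp
  have G: "\<alpha> * g1 u t + \<beta> * g2 u t = (LINT v:{u..t}|lborel. k v)"
    unfolding k_def g1_def g2_def using g_integrable[OF sub] by simp
  have S0: "0 \<le> ?S u t"
    using omega_psd[OF sub] by (simp add: psd2_def)
  have "(cmod (LINT v:{u..t}|lborel. k v))\<^sup>2 \<le> energy u t * ?S u t"
  proof (rule Cauchy_Schwarz_if_quadratic_nonneg[OF _ S0])
    fix l
    have lk: "set_integrable lborel {u..t} (\<lambda>v. cnj l * k v)"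
      using k by simp
    define R where "R v = Re (cnj l * k v)" for v
    have R: "set_integrable lborel {u..t} R"
      "(LINT v:{u..t}|lborel. R v) = Re (cnj l * (LINT v:{u..t}|lborel. k v))"
      unfolding R_def using set_integral_Re[OF lk] by (simp_all only: set_integral_mult_right)
    \<comment> \<open>Polarization at y - l e: \<open>k v\<close> is y(v) H(v) e^T, so the mixed
      term is -2 Re (cnj l * k v).\<close>
    have expand: "hform (h1 v) (h2 v) (h3 v) (y1 v - l * \<alpha>) (y2 v - l * \<beta>)
        = hform (h1 v) (h2 v) (h3 v) (y1 v) (y2 v) - 2 * R v
          + (cmod l)\<^sup>2 * (h1 v * \<alpha>\<^sup>2 + 2 * \<alpha> * \<beta> * h3 v + h2 v * \<beta>\<^sup>2)" for v
      unfolding hform_Re_Im cmod_power2 by (simp add: R_def k_def power2_eq_square algebra_simps)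
    have hi: "set_integrable lborel {u..t} (\<lambda>v. hform (h1 v) (h2 v) (h3 v) (y1 v) (y2 v))"
      using sub by (intro hform_integrable cont_sub)
    have "0 = (LINT v:{u..t}|lborel. 0::real)" by simp
    also have "\<dots> \<le> (LINT v:{u..t}|lborel. hform (h1 v) (h2 v) (h3 v) (y1 v - l * \<alpha>) (y2 v - l * \<beta>))"
    proof (rule set_integral_mono_AE)
      show "AE v\<in>{u..t} in lborel. 0 \<le> hform (h1 v) (h2 v) (h3 v) (y1 v - l * \<alpha>) (y2 v - l * \<beta>)"
        using psd_sub[OF sub] by eventually_elim (auto intro: hform_nonneg)
    qed (use sub in \<open>auto intro!: hform_integrable continuous_on_diff continuous_on_const cont_sub
          set_integrable_zero\<close>)
    also have "\<dots> = energy u t - 2 * Re (cnj l * (LINT v:{u..t}|lborel. k v)) + (cmod l)\<^sup>2 * ?S u t"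
      unfolding expand R(2)[symmetric] using R(1) hi h_sub[OF sub] by (simp add: energy_def omega_def)
    finally show "0 \<le> energy u t - 2 * Re (cnj l * (LINT v:{u..t}|lborel. k v)) + (cmod l)\<^sup>2 * ?S u t" .
  qed
  also have "\<dots> \<le> energy s t * ?S s t"
  proof (rule mult_mono)
    have "psd2 (omega h1 s u) (omega h2 s u) (omega h3 s u)"
      using assms by (intro omega_psd) auto
    then have "0 \<le> ?S s u" by (simp add: psd2_def)
    then show "?S u t \<le> ?S s t"
      unfolding omega_split[OF assms] by (simp add: algebra_simps)
    show "energy u t \<le> energy s t"
      using assms by (rule energy_mono)
    show "0 \<le> energy s t"
      using assms by (intro energy_nonneg) auto
  qed (fact S0)
  finally show ?thesis unfolding G .
qed

text \<open>Splitting y(t) into y(u) and an increment, the parallelogram bound integrates to 2 N for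
  the first part. The increment is i r (-g2, g1), a rotated row, so its H(u)-form is the form of adj
  H(u) at (g1, g2), which is at most N tr (adj H(u) \<Omega>(s,t)). Integrating in u gives 2 N det
  \<Omega>(s,t), hence the term 4 r^2 det \<Omega>.\<close>

lemma hform_omega_le:
  assumes "a \<le> s" "s \<le> t" "t \<le> c"
  shows "hform (omega h1 s t) (omega h2 s t) (omega h3 s t) (y1 t) (y2 t)
     \<le> (2 + 4 * r\<^sup>2 * detOmega h1 h2 h3 s t) * energy s t"
proof -
  have sub: "a \<le> s" "t \<le> c" using assms by auto
  define w1 w2 w3 N where w: "w1 = omega h1 s t" "w2 = omega h2 s t" "w3 = omega h3 s t" "N = energy s t"
  \<comment> \<open>This is tr (adj H(u) \<Omega>(s,t)). The adjugate is linear on 2x2 matrices, so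
    its integral is tr (adj \<Omega> \<Omega>) = 2 det \<Omega>.\<close>
  define A where "A u = h2 u * w1 - 2 * h3 u * w3 + h1 u * w2" for u
  have pw: "hform (h1 u) (h2 u) (h3 u) (y1 t) (y2 t)
      \<le> 2 * hform (h1 u) (h2 u) (h3 u) (y1 u) (y2 u) + 2 * r\<^sup>2 * N * A u"
    if u: "u \<in> {s..t}" and H: "psd2 (h1 u) (h2 u) (h3 u)" for u
  proof -
    have au: "a \<le> u" "u \<le> t" "t \<le> c" using u sub by auto
    have "hform (h1 u) (h2 u) (h3 u) (y1 t) (y2 t)
        = hform (h1 u) (h2 u) (h3 u) (y1 u - (\<i> * r) * g2 u t) (y2 u - (- (\<i> * r) * g1 u t))"
      using y_step[OF au] by (simp add: algebra_simps)
    also have "\<dots> \<le> 2 * hform (h1 u) (h2 u) (h3 u) (y1 u) (y2 u)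
        + 2 * hform (h1 u) (h2 u) (h3 u) ((\<i> * r) * g2 u t) (- (\<i> * r) * g1 u t)"
      by (rule hform_diff_le[OF H])
    also have "hform (h1 u) (h2 u) (h3 u) ((\<i> * r) * g2 u t) (- (\<i> * r) * g1 u t)
        = r\<^sup>2 * (h2 u * (cmod (g1 u t))\<^sup>2 + 2 * (- h3 u * Re (g1 u t * cnj (g2 u t))) + h1 u * (cmod (g2 u t))\<^sup>2)"
      unfolding hform_Re_Im cmod_power2 by (simp add: power2_eq_square algebra_simps)
    also have "\<dots> \<le> r\<^sup>2 * (N * A u)"
    proof (rule mult_left_mono)
      \<comment> \<open>N \<Omega>(s,t) dominates the real part of the Gram matrix of (g1, g2); this
        is the Cauchy-Schwarz bound taken over all real directions.\<close>
      have 2: "psd2 (N * w1 - (cmod (g1 u t))\<^sup>2) (N * w2 - (cmod (g2 u t))\<^sup>2)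
          (N * w3 - Re (g1 u t * cnj (g2 u t)))"
        unfolding psd2_def
      proof (intro allI)
        fix x y :: real
        have "(cmod (x * g1 u t + y * g2 u t))\<^sup>2 \<le> N * (w1 * x\<^sup>2 + 2 * w3 * x * y + w2 * y\<^sup>2)"
          unfolding w using u sub by (intro g_Cauchy_Schwarz) auto
        then show "0 \<le> (N * w1 - (cmod (g1 u t))\<^sup>2) * x\<^sup>2 + 2 * (N * w3 - Re (g1 u t * cnj (g2 u t))) * x * y
            + (N * w2 - (cmod (g2 u t))\<^sup>2) * y\<^sup>2"
          unfolding cmod_power2 by (simp add: power2_eq_square algebra_simps)
      qed
      show "h2 u * (cmod (g1 u t))\<^sup>2 + 2 * (- h3 u * Re (g1 u t * cnj (g2 u t))) + h1 u * (cmod (g2 u t))\<^sup>2 \<le> N * A u"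
        using psd2_trace_mult_nonneg[OF psd2_adjugate[OF H] 2] by (simp add: A_def algebra_simps)
    qed simp
    finally show ?thesis by simp
  qed
  have hi: "set_integrable lborel {s..t} (\<lambda>u. hform (h1 u) (h2 u) (h3 u) (y1 u) (y2 u))"
    using sub by (intro hform_integrable cont_sub)
  have Ai: "set_integrable lborel {s..t} A"
    unfolding A_def using h_sub[OF sub] by (simp add: mult.assoc)
  have "hform w1 w2 w3 (y1 t) (y2 t) = (LINT u:{s..t}|lborel. hform (h1 u) (h2 u) (h3 u) (y1 t) (y2 t))"
  proof -
    have "(LINT u:{s..t}|lborel. hform (h1 u) (h2 u) (h3 u) (y1 t) (y2 t))
      = (LINT u:{s..t}|lborel. (cmod (y1 t))\<^sup>2 * h1 u + 2 * Re (y1 t * cnj (y2 t)) * h3 u + (cmod (y2 t))\<^sup>2 * h2 u)"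
      by (simp add: hform_def mult_ac)
    also have "\<dots> = hform w1 w2 w3 (y1 t) (y2 t)"
      using h_sub[OF sub] by (simp add: hform_def w omega_def)
    finally show ?thesis ..
  qed
  also have "\<dots> \<le> (LINT u:{s..t}|lborel. 2 * hform (h1 u) (h2 u) (h3 u) (y1 u) (y2 u) + 2 * r\<^sup>2 * N * A u)"
  proof (rule set_integral_mono_AE)
    show "AE u\<in>{s..t} in lborel. hform (h1 u) (h2 u) (h3 u) (y1 t) (y2 t)
        \<le> 2 * hform (h1 u) (h2 u) (h3 u) (y1 u) (y2 u) + 2 * r\<^sup>2 * N * A u"
      using psd_sub[OF sub] by eventually_elim (use pw in blast)
  qed (use sub hi Ai in \<open>auto intro!: hform_integrable continuous_on_const set_integral_add\<close>)
  also have "\<dots> = 2 * N + 2 * r\<^sup>2 * N * (LINT u:{s..t}|lborel. A u)"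
    using hi Ai by (simp add: w energy_def)
  also have "(LINT u:{s..t}|lborel. A u) = 2 * detOmega h1 h2 h3 s t"
    unfolding A_def using h_sub[OF sub]
    by (simp add: mult.assoc) (simp add: detOmega_def w omega_def power2_eq_square)
  finally show ?thesis by (simp add: w algebra_simps)
qed

section \<open>Initial values and the energy identity\<close>

lemma y_initial: "y1 a = 0" "y2 a = 1"
proof -
  have "(LINT u:{a..a}|lborel. f u) = 0" for f :: "real \<Rightarrow> complex"
    unfolding set_lebesgue_integral_def
  proof (rule integral_eq_zero_AE)
    show "AE u in lborel. indicator {a..a} u *\<^sub>R f u = 0"
      using AE_lborel_singleton[of a] by eventually_elim (auto simp: indicator_def)
  qed
  then show "y1 a = 0" "y2 a = 1"
    using y1[of a] y2[of a] ac by auto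
qed

text \<open>Since y1(a) = 0, all of y1(t) is increment, and Cauchy-Schwarz applies in the direction
  (0, 1).\<close>

lemma y1_le:
  assumes "t \<in> {a..c}"
  shows "(cmod (y1 t))\<^sup>2 \<le> r\<^sup>2 * (energy a t * omega h2 a t)"
proof -
  have "(cmod (y1 t))\<^sup>2 = r\<^sup>2 * (cmod (g2 a t))\<^sup>2"
    using y1[OF assms] r by (simp add: g2_def norm_mult power_mult_distrib)
  also have "\<dots> \<le> r\<^sup>2 * (energy a t * omega h2 a t)"
    using g_Cauchy_Schwarz[of a a t 0 1] assms by (intro mult_left_mono) auto
  finally show ?thesis .
qed

text \<open>The derivative of y2 * cnj y1 has imaginary part r y H y^*, and y1(a) = 0 removes the
  boundary term. Started at s > a, the identity leaves the nonnegative boundary term E(s), whence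
  only an inequality in \<open>energy_le_Im\<close>.\<close>

lemma Im_eq_energy:
  assumes "t \<in> {a..c}"
  shows "Im (y2 t * cnj (y1 t)) = r * energy a t"
proof -
  have sub: "a \<le> a" "t \<le> c" "a \<le> t" using assms by auto
  define f where "f u = (\<i> * r) * (y1 u * h1 u + y2 u * h3 u)" for u
  define g where "g u = cnj (- (\<i> * r) * (y1 u * h3 u + y2 u * h2 u))" for u
  have f: "set_integrable lborel {a..t} f"
    unfolding f_def using g_integrable[OF sub(1,2)] by simp
  have g': "set_integrable lborel {a..t} (\<lambda>u. - (\<i> * r) * (y1 u * h3 u + y2 u * h2 u))"
    using g_integrable[OF sub(1,2)] by (intro set_integrable_mult_right)
  have g: "set_integrable lborel {a..t} g"
    unfolding g_def by (rule set_integral_cnj(1)[OF g'])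
  have "y2 t * cnj (y1 t) = y2 a * cnj (y1 a) + (LINT u:{a..t}|lborel. cnj (y1 u) * f u + y2 u * g u)"
  proof (rule set_integral_by_parts_Icc[OF sub(3) f g])
    fix x assume x: "x \<in> {a..t}"
    then show "y2 x = y2 a + (LINT u:{a..x}|lborel. f u)"
      using y2[of x] sub by (simp add: f_def y_initial)
    have "set_integrable lborel {a..x} (\<lambda>u. - (\<i> * r) * (y1 u * h3 u + y2 u * h2 u))"
      using g_integrable[of a x] x sub by (intro set_integrable_mult_right) auto
    from set_integral_cnj(2)[OF this]
    have "(LINT u:{a..x}|lborel. g u) = cnj (LINT u:{a..x}|lborel. - (\<i> * r) * (y1 u * h3 u + y2 u * h2 u))"
      unfolding g_def .
    also have "\<dots> = cnj (- (\<i> * r) * (LINT u:{a..x}|lborel. y1 u * h3 u + y2 u * h2 u))"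
      by (simp only: set_integral_mult_right)
    also have "\<dots> = cnj (y1 x)"
      using y1[of x] x sub by (simp only: atLeastAtMost_iff) simp
    finally show "cnj (y1 x) = cnj (y1 a) + (LINT u:{a..x}|lborel. g u)"
      by (simp add: y_initial)
  qed
  also have "\<dots> = (LINT u:{a..t}|lborel. cnj (y1 u) * f u + y2 u * g u)"
    by (simp add: y_initial)
  finally have "Im (y2 t * cnj (y1 t)) = Im (LINT u:{a..t}|lborel. cnj (y1 u) * f u + y2 u * g u)"
    by simp
  also have "\<dots> = (LINT u:{a..t}|lborel. Im (cnj (y1 u) * f u + y2 u * g u))"
    using sub f g
    by (intro set_integral_Im(2)[symmetric] set_integral_add set_integrable_continuous_mult cont_sub continuous_intros) auto
  also have "(\<lambda>u. Im (cnj (y1 u) * f u + y2 u * g u)) = (\<lambda>u. r * hform (h1 u) (h2 u) (h3 u) (y1 u) (y2 u))"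
    unfolding hform_Re_Im f_def g_def by (simp add: fun_eq_iff power2_eq_square algebra_simps)
  finally show ?thesis by (simp add: energy_def)
qed

lemma energy_le_Im:
  assumes "a \<le> s" "s \<le> t" "t \<le> c"
  shows "r * energy s t \<le> Im (y2 t * cnj (y1 t))"
  using Im_eq_energy[of t] energy_mono[of a s t] assms r by simp

lemma Im_nonneg: "t \<in> {a..c} \<Longrightarrow> 0 \<le> Im (y2 t * cnj (y1 t))"
  using Im_eq_energy[of t] energy_nonneg[of a t] r by simp

text \<open>In 2 Re (cnj y2 * y2') the h3 term is purely imaginary before taking the real part and
  drops out; this is why h1 alone is the factor in the kernel.\<close>

lemma norm_y2_square:
  assumes "t \<in> {a..c}"
  shows "(cmod (y2 t))\<^sup>2 = 1 + (LINT u:{a..t}|lborel. 2 * r * Im (y2 u * cnj (y1 u)) * h1 u)"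
proof -
  have sub: "a \<le> a" "t \<le> c" "a \<le> t" using assms by auto
  define f where "f u = (\<i> * r) * (y1 u * h1 u + y2 u * h3 u)" for u
  define g where "g u = cnj (f u)" for u
  have fx: "set_integrable lborel {a..x} f" if "x \<le> c" for x
    unfolding f_def using g_integrable[of a x] that by simp
  note f = fx[OF sub(2)]
  have g: "set_integrable lborel {a..t} g"
    unfolding g_def by (rule set_integral_cnj(1)[OF f])
  have "y2 t * cnj (y2 t) = y2 a * cnj (y2 a) + (LINT u:{a..t}|lborel. cnj (y2 u) * f u + y2 u * g u)"
  proof (rule set_integral_by_parts_Icc[OF sub(3) f g])
    fix x assume x: "x \<in> {a..t}"
    then show *: "y2 x = y2 a + (LINT u:{a..x}|lborel. f u)"
      using y2[of x] sub by (simp add: f_def y_initial)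
    show "cnj (y2 x) = cnj (y2 a) + (LINT u:{a..x}|lborel. g u)"
      unfolding g_def using x sub by (subst *) (simp add: set_integral_cnj(2)[OF fx])
  qed
  also have "\<dots> = 1 + (LINT u:{a..t}|lborel. cnj (y2 u) * f u + y2 u * g u)"
    by (simp add: y_initial)
  finally have "Re (y2 t * cnj (y2 t)) = 1 + Re (LINT u:{a..t}|lborel. cnj (y2 u) * f u + y2 u * g u)"
    by simp
  also have "Re (y2 t * cnj (y2 t)) = (cmod (y2 t))\<^sup>2"
    by (simp add: cmod_power2) (simp add: power2_eq_square)
  also have "Re (LINT u:{a..t}|lborel. cnj (y2 u) * f u + y2 u * g u)
      = (LINT u:{a..t}|lborel. Re (cnj (y2 u) * f u + y2 u * g u))"
    using sub f g
    by (intro set_integral_Re(2)[symmetric] set_integral_add set_integrable_continuous_mult cont_sub continuous_intros) auto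
  also have "(\<lambda>u. Re (cnj (y2 u) * f u + y2 u * g u)) = (\<lambda>u. 2 * r * Im (y2 u * cnj (y1 u)) * h1 u)"
    unfolding f_def g_def by (simp add: fun_eq_iff algebra_simps)
  finally show ?thesis .
qed

text \<open>The density of log |y2| with respect to h1 dt. The kernel contains the same factor h1,
  so splitting it off reduces the comparison to one at each t.\<close>

definition "log_rate t = r * Im (y2 t * cnj (y1 t)) / (cmod (y2 t))\<^sup>2"

section \<open>The logarithm of |y2| as an integral\<close>

lemma h1_nonneg_AE:
  assumes "a \<le> s" "t \<le> c"
  shows "AE u in lborel. u \<in> {s..t} \<longrightarrow> 0 \<le> h1 u"
  using psd_sub[OF assms] by eventually_elim (auto dest: psd2D)

lemma norm_y2_square_integrable:
  assumes "t \<in> {a..c}"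
  shows "set_integrable lborel {a..t} (\<lambda>u. 2 * r * Im (y2 u * cnj (y1 u)) * h1 u)"
  using assms by (intro set_integrable_continuous_mult h_sub continuous_intros cont_sub) auto

text \<open>|y2|^2 starts at 1 and has nonnegative density. In particular y2 has no zero, which
  legitimates the division in \<open>log_rate\<close>.\<close>

lemma norm_y2_ge_1:
  assumes "t \<in> {a..c}"
  shows "1 \<le> (cmod (y2 t))\<^sup>2"
proof -
  have t: "a \<le> a" "t \<le> c" using assms by auto
  have "0 = (LINT u:{a..t}|lborel. 0::real)" by simp
  also have "\<dots> \<le> (LINT u:{a..t}|lborel. 2 * r * Im (y2 u * cnj (y1 u)) * h1 u)"
  proof (rule set_integral_mono_AE[OF _ norm_y2_square_integrable[OF assms]])
    show "AE u\<in>{a..t} in lborel. 0 \<le> 2 * r * Im (y2 u * cnj (y1 u)) * h1 u"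
      using h1_nonneg_AE[OF t]
    proof eventually_elim
      case (elim u)
      show ?case
      proof
        assume u: "u \<in> {a..t}"
        then have "0 \<le> Im (y2 u * cnj (y1 u))" using assms by (intro Im_nonneg) auto
        then show "0 \<le> 2 * r * Im (y2 u * cnj (y1 u)) * h1 u"
          using elim u r by (intro mult_nonneg_nonneg) auto
      qed
    qed
  qed (rule set_integrable_zero)
  finally show ?thesis
    using norm_y2_square[OF assms] by simp
qed

lemma log_rate_integrable: "set_integrable lborel {a..c} (\<lambda>u. log_rate u * h1 u)"
  unfolding log_rate_def
  using norm_y2_ge_1 by (intro set_integrable_continuous_mult h continuous_intros cont) force

lemma ln_norm_y2: "ln (cmod (y2 c)) = (LINT u:{a..c}|lborel. log_rate u * h1 u)"
proof -
  have "ln ((cmod (y2 c))\<^sup>2) = ln ((cmod (y2 a))\<^sup>2)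
      + (LINT u:{a..c}|lborel. inverse ((cmod (y2 u))\<^sup>2) * (2 * r * Im (y2 u * cnj (y1 u)) * h1 u))"
  proof (rule ln_eq_set_integral_log_derivative[OF ac])
    show "set_integrable lborel {a..c} (\<lambda>u. 2 * r * Im (y2 u * cnj (y1 u)) * h1 u)"
      using norm_y2_square_integrable[of c] ac by simp
    fix x assume x: "x \<in> {a..c}"
    then show "0 < (cmod (y2 x))\<^sup>2" using norm_y2_ge_1[of x] by linarith
    show "(cmod (y2 x))\<^sup>2 = (cmod (y2 a))\<^sup>2 + (LINT u:{a..x}|lborel. 2 * r * Im (y2 u * cnj (y1 u)) * h1 u)"
      using norm_y2_square[OF x] by (simp add: y_initial)
  qed
  also have "(\<lambda>u. inverse ((cmod (y2 u))\<^sup>2) * (2 * r * Im (y2 u * cnj (y1 u)) * h1 u))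
      = (\<lambda>u. 2 * (log_rate u * h1 u))"
    by (rule ext) (simp only: log_rate_def divide_inverse mult_ac)
  finally show ?thesis
    by (simp add: y_initial ln_realpow)
qed

lemma log_rate_nonneg: "t \<in> {a..c} \<Longrightarrow> 0 \<le> log_rate t"
  unfolding log_rate_def using Im_nonneg r by simp

text \<open>Nonnegative integrals allow monotone convergence up to b and a comparison that does not
  presuppose integrability of the kernel.\<close>

lemma ln_norm_y2_nn_integral:
  "ennreal (ln (cmod (y2 c))) = (\<integral>\<^sup>+u\<in>{a..c}. ennreal (log_rate u * h1 u) \<partial>lborel)"
proof -
  have "ennreal (LINT u|lborel. indicator {a..c} u *\<^sub>R (log_rate u * h1 u))
      = (\<integral>\<^sup>+u. ennreal (indicator {a..c} u *\<^sub>R (log_rate u * h1 u)) \<partial>lborel)"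
  proof (rule nn_integral_eq_integral[symmetric])
    show "integrable lborel (\<lambda>u. indicator {a..c} u *\<^sub>R (log_rate u * h1 u))"
      using log_rate_integrable unfolding set_integrable_def .
    have "AE u in lborel. u \<in> {a..c} \<longrightarrow> 0 \<le> h1 u" by (rule h1_nonneg_AE) auto
    then show "AE u in lborel. 0 \<le> indicator {a..c} u *\<^sub>R (log_rate u * h1 u)"
      by eventually_elim (auto simp: indicator_def log_rate_nonneg)
  qed
  also have "\<dots> = (\<integral>\<^sup>+u\<in>{a..c}. ennreal (log_rate u * h1 u) \<partial>lborel)"
    by (intro nn_integral_cong) (auto simp: indicator_def)
  finally show ?thesis
    unfolding ln_norm_y2 set_lebesgue_integral_def .
qed

text \<open>The factor 2 + 4 * cp is the constant of \<open>hform_omega_le\<close> after r^2 det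
  \<Omega> \<le> cp; the factor cm is the loss from the lower determinant bound.\<close>

lemma log_rate_bounds_of_det_ge:
  assumes "a \<le> s" "s \<le> t" "t \<le> c" and cm: "cm > 0"
    and det: "cm / r\<^sup>2 \<le> detOmega h1 h2 h3 s t" "detOmega h1 h2 h3 s t \<le> cp / r\<^sup>2"
  shows "cm / (2 + 4 * cp) * (1 / omega h1 s t) \<le> log_rate t"
    "log_rate t \<le> (2 + 4 * cp) * (1 / omega h1 s t)" "omega h1 s t > 0"
proof -
  define \<kappa> where "\<kappa> = 2 + 4 * cp"
  have t: "t \<in> {a..c}" using assms by auto
  have "cm / r\<^sup>2 > 0" using cm r by simp
  then have det0: "0 < detOmega h1 h2 h3 s t" using det by linarith
  moreover have "psd2 (omega h1 s t) (omega h2 s t) (omega h3 s t)"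
    using assms by (intro omega_psd) auto
  \<comment> \<open>If \<omega>1 vanished, the determinant would be -\<omega>3^2 \<le> 0.\<close>
  ultimately show w: "omega h1 s t > 0"
    using psd2D(1)[of "omega h1 s t"] unfolding detOmega_def
    by (cases "omega h1 s t = 0") (auto simp: less_le)
  have N: "0 \<le> energy s t" using assms by (intro energy_nonneg) auto
  have rd: "r\<^sup>2 * detOmega h1 h2 h3 s t \<le> cp" using det(2) r by (simp add: field_simps)
  have "0 < r\<^sup>2 * detOmega h1 h2 h3 s t" using det0 r by simp
  then have \<kappa>: "\<kappa> > 0" using rd by (simp add: \<kappa>_def)
  have "hform (omega h1 s t) (omega h2 s t) (omega h3 s t) (y1 t) (y2 t) \<le> (2 + 4 * r\<^sup>2 * detOmega h1 h2 h3 s t) * energy s t"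
    using assms by (intro hform_omega_le)
  also have "\<dots> \<le> \<kappa> * energy s t"
    using rd N by (intro mult_right_mono) (auto simp: \<kappa>_def)
  finally have hf: "hform (omega h1 s t) (omega h2 s t) (omega h3 s t) (y1 t) (y2 t) \<le> \<kappa> * energy s t" .
  have q: "(cmod (y2 t))\<^sup>2 > 0" using norm_y2_ge_1[OF t] by linarith
  note lb = Im_bounds_of_det_ge[OF r refl N energy_le_Im[OF assms(1-3)] hf w less_imp_le[OF \<kappa>] det(1)[unfolded detOmega_def] cm]
  show "cm / (2 + 4 * cp) * (1 / omega h1 s t) \<le> log_rate t"
    using lb(1) q w \<kappa> unfolding \<kappa>_def[symmetric] log_rate_def by (simp add: field_simps)
  show "log_rate t \<le> (2 + 4 * cp) * (1 / omega h1 s t)"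
    using lb(2) q w \<kappa> unfolding \<kappa>_def[symmetric] log_rate_def by (simp add: field_simps)
qed

text \<open>\<open>Im_bounds_of_zero_start\<close> produces \<kappa> / r^2 + \<omega>3^2 and 1 / r^2
  + \<omega>3^2. Exchanging these for the denominator cp / r^2 + \<omega>3^2 of the kernel costs the
  factors \<kappa> / cp + 1 and 1 + cp.\<close>

lemma log_rate_bounds_of_det_le:
  assumes t: "t \<in> {a..c}" and cp: "cp > 0" and det: "detOmega h1 h2 h3 a t \<le> cp / r\<^sup>2"
  defines "\<kappa> \<equiv> 2 + 4 * cp"
  shows "1 / (2 * (\<kappa> / cp + 1)) * (omega h2 a t / (cp / r\<^sup>2 + (omega h3 a t)\<^sup>2)) \<le> log_rate t"
    "log_rate t \<le> \<kappa> * (3 + 2 * \<kappa>) * (1 + cp) * (omega h2 a t / (cp / r\<^sup>2 + (omega h3 a t)\<^sup>2))"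
proof -
  define K where "K = cp / r\<^sup>2 + (omega h3 a t)\<^sup>2"
  define w where "w = omega h3 a t"
  have K: "K > 0" unfolding K_def using cp r by (intro add_pos_nonneg) auto
  have \<kappa>: "\<kappa> > 0" using cp by (simp add: \<kappa>_def)
  have at: "a \<le> a" "a \<le> t" "t \<le> c" using t by auto
  have N: "0 \<le> energy a t" using at by (intro energy_nonneg) auto
  have rd: "r\<^sup>2 * detOmega h1 h2 h3 a t \<le> cp" using det r by (simp add: field_simps)
  have "hform (omega h1 a t) (omega h2 a t) (omega h3 a t) (y1 t) (y2 t) \<le> (2 + 4 * r\<^sup>2 * detOmega h1 h2 h3 a t) * energy a t"
    using at by (intro hform_omega_le)
  also have "\<dots> \<le> \<kappa> * energy a t"
    using rd N by (intro mult_right_mono) (auto simp: \<kappa>_def)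
  finally have hf: "hform (omega h1 a t) (omega h2 a t) (omega h3 a t) (y1 t) (y2 t) \<le> \<kappa> * energy a t" .
  have q: "(cmod (y2 t))\<^sup>2 > 0" using norm_y2_ge_1[OF t] by linarith
  have P: "psd2 (omega h1 a t) (omega h2 a t) (omega h3 a t)" using at by (intro omega_psd)
  define E where "E = r * Im (y2 t * cnj (y1 t))"
  have E0: "E \<ge> 0" unfolding E_def using Im_nonneg[OF t] r by simp
  note eb = Im_bounds_of_zero_start[OF r refl N Im_eq_energy[OF t, symmetric] hf P less_imp_le[OF \<kappa>] y1_le[OF t],
      folded E_def w_def]
  have KE: "K = cp / r\<^sup>2 + w\<^sup>2" by (simp add: K_def w_def)
  have "\<kappa> / r\<^sup>2 + w\<^sup>2 \<le> (\<kappa> / cp + 1) * K"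
  proof -
    have "(\<kappa> / cp + 1) * K = \<kappa> / r\<^sup>2 + w\<^sup>2 + (\<kappa> / cp * w\<^sup>2 + cp / r\<^sup>2)"
      using cp r by (simp add: KE field_simps)
    moreover have "0 \<le> \<kappa> / cp * w\<^sup>2 + cp / r\<^sup>2" using \<kappa> cp by simp
    ultimately show ?thesis by linarith
  qed
  then have "2 * (\<kappa> / r\<^sup>2 + w\<^sup>2) * E \<le> 2 * ((\<kappa> / cp + 1) * K) * E"
    using E0 by (intro mult_right_mono) auto
  with eb(1) have 1: "omega h2 a t * (cmod (y2 t))\<^sup>2 \<le> 2 * ((\<kappa> / cp + 1) * K) * E" by linarith
  have "(1 + cp) * (1 / r\<^sup>2 + w\<^sup>2) = K + (1 / r\<^sup>2 + cp * w\<^sup>2)"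
    by (simp add: KE algebra_simps add_divide_distrib)
  moreover have "0 \<le> 1 / r\<^sup>2 + cp * w\<^sup>2" using cp by simp
  ultimately have "K \<le> (1 + cp) * (1 / r\<^sup>2 + w\<^sup>2)" by linarith
  then have "K * E \<le> (1 + cp) * (1 / r\<^sup>2 + w\<^sup>2) * E"
    using E0 by (intro mult_right_mono) auto
  also have "\<dots> \<le> (1 + cp) * (\<kappa> * (3 + 2 * \<kappa>) * (omega h2 a t * (cmod (y2 t))\<^sup>2))"
    unfolding mult.assoc[of "1 + cp"] using eb(2) cp by (intro mult_left_mono) auto
  finally have 2: "K * E \<le> (1 + cp) * (\<kappa> * (3 + 2 * \<kappa>) * (omega h2 a t * (cmod (y2 t))\<^sup>2))" .
  have L: "log_rate t = E / (cmod (y2 t))\<^sup>2" by (simp add: log_rate_def E_def)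
  have k1: "\<kappa> / cp + 1 > 0" using \<kappa> cp by (simp add: add_pos_pos)
  show "1 / (2 * (\<kappa> / cp + 1)) * (omega h2 a t / (cp / r\<^sup>2 + (omega h3 a t)\<^sup>2)) \<le> log_rate t"
    unfolding K_def[symmetric] L
  proof -
    define d where "d = \<kappa> / cp + 1"
    have "omega h2 a t * (cmod (y2 t))\<^sup>2 \<le> 2 * d * K * E" and "d > 0"
      using 1 k1 by (simp_all only: d_def mult.assoc)
    then show "1 / (2 * (\<kappa> / cp + 1)) * (omega h2 a t / K) \<le> E / (cmod (y2 t))\<^sup>2"
      unfolding d_def[symmetric] using K q by (simp add: field_simps)
  qed
  show "log_rate t \<le> \<kappa> * (3 + 2 * \<kappa>) * (1 + cp) * (omega h2 a t / (cp / r\<^sup>2 + (omega h3 a t)\<^sup>2))"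
    unfolding K_def[symmetric] L using 2 q K by (simp add: pos_divide_le_eq pos_le_divide_eq mult_ac)
qed

end

section \<open>Comparison with the kernel\<close>

lemma row_mult_hmat_Jmat:
  fixes A :: "complex^2^2"
  shows "(A ** hmat h1 h2 h3 t ** Jmat) $ 2 $ 1 = A $ 2 $ 1 * h3 t + A $ 2 $ 2 * h2 t"
    "(A ** hmat h1 h2 h3 t ** Jmat) $ 2 $ 2 = - (A $ 2 $ 1 * h1 t + A $ 2 $ 2 * h3 t)"
  by (simp_all add: matrix_matrix_mult_def hmat_def Jmat_def sum_2)

lemma mult_mat_component:
  fixes A :: "complex^2^2"
  shows "(A ** mat z) $ i $ j = A $ i $ j * z"
  by (simp add: matrix_matrix_mult_def mat_def if_distrib[of "\<lambda>v. _ * v"] cong: if_cong)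

lemma set_integral_component:
  fixes f :: "real \<Rightarrow> complex^2^2"
  assumes "set_integrable lborel S f"
  shows "set_integrable lborel S (\<lambda>t. f t $ i $ j)" "(LINT t:S|lborel. f t) $ i $ j = (LINT t:S|lborel. f t $ i $ j)"
proof -
  have bl: "bounded_linear (\<lambda>A::complex^2^2. A $ i $ j)"
    by (intro bounded_linear_compose[OF bounded_linear_vec_nth] bounded_linear_vec_nth)
  show "set_integrable lborel S (\<lambda>t. f t $ i $ j)"
    using integrable_bounded_linear[OF bl assms[unfolded set_integrable_def]]
    by (simp add: set_integrable_def)
  show "(LINT t:S|lborel. f t) $ i $ j = (LINT t:S|lborel. f t $ i $ j)"
    using integral_bounded_linear[OF bl assms[unfolded set_integrable_def]]
    by (simp add: set_lebesgue_integral_def)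
qed

text \<open>The equation acts on each row of W separately, so the lower row satisfies a closed
  system. As x is an extended real, x = b is covered, also for b = \<infinity>.\<close>

lemma fundamental_solution_row:
  assumes "fundamental_solution a b h1 h2 h3 W" "x \<in> domH a b h1 h2"
  defines "S \<equiv> {t. a \<le> t \<and> ereal t \<le> x}"
  shows "set_integrable lborel S (\<lambda>t. W t z $ 2 $ 1 * h3 t + W t z $ 2 $ 2 * h2 t)"
    "set_integrable lborel S (\<lambda>t. W t z $ 2 $ 1 * h1 t + W t z $ 2 $ 2 * h3 t)"
    "W x z $ 2 $ 1 = - z * (LINT t:S|lborel. W t z $ 2 $ 1 * h3 t + W t z $ 2 $ 2 * h2 t)"
    "W x z $ 2 $ 2 = 1 + z * (LINT t:S|lborel. W t z $ 2 $ 1 * h1 t + W t z $ 2 $ 2 * h3 t)"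
proof -
  have i: "set_integrable lborel S (\<lambda>t. W (ereal t) z ** hmat h1 h2 h3 t ** Jmat)"
    and e: "W x z = mat 1 - (LINT t:S|lborel. W (ereal t) z ** hmat h1 h2 h3 t ** Jmat) ** mat z"
    using assms unfolding fundamental_solution_def S_def by blast+
  note c = set_integral_component[OF i, where i=2, unfolded row_mult_hmat_Jmat]
  note c1 = c[where j=1, unfolded row_mult_hmat_Jmat] and c2 = c[where j=2, unfolded row_mult_hmat_Jmat]
  show "set_integrable lborel S (\<lambda>t. W t z $ 2 $ 1 * h3 t + W t z $ 2 $ 2 * h2 t)"
    by (rule c1(1))
  show k: "set_integrable lborel S (\<lambda>t. W t z $ 2 $ 1 * h1 t + W t z $ 2 $ 2 * h3 t)"
  proof -
    have "set_integrable lborel S (\<lambda>t. - 1 * - (W t z $ 2 $ 1 * h1 t + W t z $ 2 $ 2 * h3 t))"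
      using c2(1) by (intro set_integrable_mult_right)
    then show ?thesis by (simp only: mult_minus1 minus_minus)
  qed
  have m: "(mat 1 :: complex^2^2) $ 2 $ 1 = 0" "(mat 1 :: complex^2^2) $ 2 $ 2 = 1"
    by (simp_all add: mat_def)
  show "W x z $ 2 $ 1 = - z * (LINT t:S|lborel. W t z $ 2 $ 1 * h3 t + W t z $ 2 $ 2 * h2 t)"
    by (simp add: e mult_mat_component c1(2) m)
  show "W x z $ 2 $ 2 = 1 + z * (LINT t:S|lborel. W t z $ 2 $ 1 * h1 t + W t z $ 2 $ 2 * h3 t)"
    unfolding e by (simp add: mult_mat_component c2(2) m set_integral_uminus[OF k] del: minus_add_distrib)
qed

lemma hamiltonian_integrable:
  assumes "hamiltonian a b h1 h2 h3" "a \<le> c" "ereal c < b"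
  shows "set_integrable lborel {a..c} h1" "set_integrable lborel {a..c} h2" "set_integrable lborel {a..c} h3"
proof -
  \<comment> \<open>Integrability is given on open intervals (a, d) with d < b; d is taken beyond c,
    and the null point a is added afterwards.\<close>
  obtain d where d: "ereal c < ereal d" "ereal d < b"
    using ereal_dense2[OF assms(3)] by blast
  have *: "set_integrable lborel {a..c} k" if "set_integrable lborel {a<..<d} k" for k :: "real \<Rightarrow> real"
  proof -
    have "set_integrable lborel {a<..c} k"
      by (rule set_integrable_subset[OF that]) (use d in auto)
    then show ?thesis
      by (rule set_integrable_discrete_difference[where X="{a}", THEN iffD1, rotated -1]) (use assms in auto)
  qed
  show "set_integrable lborel {a..c} h1" "set_integrable lborel {a..c} h2" "set_integrable lborel {a..c} h3"
    using assms d by (auto simp: hamiltonian_def intro!: *)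
qed

lemma hamiltonian_canonical_row:
  assumes H: "hamiltonian a b h1 h2 h3" and W: "fundamental_solution a b h1 h2 h3 W"
    and r: "r > 0" and c: "a \<le> c" "ereal c < b"
  shows "canonical_row a c r h1 h2 h3 (\<lambda>t. W t (\<i> * r) $ 2 $ 1) (\<lambda>t. W t (\<i> * r) $ 2 $ 2)"
proof
  have S: "{t. a \<le> t \<and> ereal t \<le> ereal x} = {a..x}" for x by auto
  have dom: "ereal x \<in> domH a b h1 h2" if "x \<in> {a..c}" for x
    using that c le_less_trans[of "ereal x" "ereal c" b] by (auto simp: domH_def)
  note F = fundamental_solution_row[OF W dom, unfolded S]
  show "set_integrable lborel {a..c} h1" "set_integrable lborel {a..c} h2" "set_integrable lborel {a..c} h3"
    by (rule hamiltonian_integrable[OF H c])+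
  show "a \<le> c" "r > 0" by fact+
  have "AE t in lborel. t \<in> ivl a b \<longrightarrow> psd2 (h1 t) (h2 t) (h3 t)"
    using H by (simp add: hamiltonian_def psd2_def)
  \<comment> \<open>Positivity is given on the open interval, so the point a is discarded as a null
    set.\<close>
  then show "AE t in lborel. t \<in> {a..c} \<longrightarrow> psd2 (h1 t) (h2 t) (h3 t)"
    using AE_lborel_singleton[of a]
    by eventually_elim (use c le_less_trans[of _ "ereal c" b] in \<open>auto simp: ivl_def\<close>)
  show "continuous_on {a..c} (\<lambda>t. W t (\<i> * r) $ 2 $ 1)"
    by (rule continuous_on_eq[OF _ F(3)[symmetric]])
       (use c in \<open>auto intro!: continuous_on_mult_left continuous_on_minus continuous_on_set_integral_Icc F(1)\<close>)
  show "continuous_on {a..c} (\<lambda>t. W t (\<i> * r) $ 2 $ 2)"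
    by (rule continuous_on_eq[OF _ F(4)[symmetric]])
       (use c in \<open>auto intro!: continuous_on_mult_left continuous_on_add continuous_on_const continuous_on_set_integral_Icc F(2)\<close>)
  fix x assume x: "x \<in> {a..c}"
  show "W x (\<i> * r) $ 2 $ 1 = - (\<i> * r) *
      (LINT u:{a..x}|lborel. W u (\<i> * r) $ 2 $ 1 * h3 u + W u (\<i> * r) $ 2 $ 2 * h2 u)"
    by (rule F(3)[OF x])
  show "W x (\<i> * r) $ 2 $ 2 = 1 + (\<i> * r) *
      (LINT u:{a..x}|lborel. W u (\<i> * r) $ 2 $ 1 * h1 u + W u (\<i> * r) $ 2 $ 2 * h3 u)"
    by (rule F(4)[OF x])
qed

text \<open>\<open>canonical_row.log_rate\<close> does not involve the right endpoint c, so one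
  integrand serves all c < b, and x = b is reached by a limit. \<open>S\<close> omits b because the
  row is treated on [a,c] with c < b only.\<close>

lemma ln_w22_nn_integral:
  assumes H: "hamiltonian a b h1 h2 h3" and W: "fundamental_solution a b h1 h2 h3 W"
    and r: "r > 0" and x: "x \<in> domH a b h1 h2"
  defines "y1 \<equiv> \<lambda>t. W (ereal t) (\<i> * r) $ 2 $ 1" and "y2 \<equiv> \<lambda>t. W (ereal t) (\<i> * r) $ 2 $ 2"
  defines "\<psi> \<equiv> \<lambda>t. canonical_row.log_rate r y1 y2 t * h1 t"
  defines "S \<equiv> {t. a \<le> t \<and> ereal t \<le> x \<and> ereal t < b}"
  shows "(\<lambda>t. ennreal (\<psi> t) * indicator S t) \<in> borel_measurable lborel"
    and "(\<integral>\<^sup>+t\<in>S. ennreal (\<psi> t) \<partial>lborel) = ennreal (ln (cmod (W x (\<i> * r) $ 2 $ 2)))"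
    and "0 \<le> ln (cmod (W x (\<i> * r) $ 2 $ 2))"
proof -
  have row: "canonical_row a c r h1 h2 h3 y1 y2" if "a \<le> c" "ereal c < b" for c
    unfolding y1_def y2_def using that by (intro hamiltonian_canonical_row[OF H W r])
  have meas: "(\<lambda>t. ennreal (\<psi> t) * indicator {a..c} t) \<in> borel_measurable lborel"
    if "a \<le> c" "ereal c < b" for c
  proof -
    have "(\<lambda>t. indicator {a..c} t *\<^sub>R \<psi> t) \<in> borel_measurable lborel"
      using canonical_row.log_rate_integrable[OF row[OF that]]
      unfolding set_integrable_def \<psi>_def by (rule borel_measurable_integrable)
    then have "(\<lambda>t. ennreal (indicator {a..c} t *\<^sub>R \<psi> t)) \<in> borel_measurable lborel"
      by measurable
    also have "(\<lambda>t. ennreal (indicator {a..c} t *\<^sub>R \<psi> t)) = (\<lambda>t. ennreal (\<psi> t) * indicator {a..c} t)"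
      by (auto simp: indicator_def fun_eq_iff)
    finally show ?thesis .
  qed
  have val: "(\<integral>\<^sup>+t\<in>{a..c}. ennreal (\<psi> t) \<partial>lborel) = ennreal (ln (cmod (y2 c)))" if "a \<le> c" "ereal c < b" for c
    unfolding \<psi>_def by (rule canonical_row.ln_norm_y2_nn_integral[OF row[OF that], symmetric])
  have ge1: "1 \<le> cmod (y2 c)" if "a \<le> c" "ereal c < b" for c
    using canonical_row.norm_y2_ge_1[OF row[OF that], of c] that
    by (smt (verit) atLeastAtMost_iff norm_ge_zero power2_le_imp_le one_power2)
  have "(\<lambda>t. ennreal (\<psi> t) * indicator S t) \<in> borel_measurable lborel \<and>
    (\<integral>\<^sup>+t\<in>S. ennreal (\<psi> t) \<partial>lborel) = ennreal (ln (cmod (W x (\<i> * r) $ 2 $ 2))) \<and>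
    1 \<le> cmod (W x (\<i> * r) $ 2 $ 2)"
  proof (cases "x < b")
    case True
    then obtain c where c: "x = ereal c" "a \<le> c"
      using x by (cases x) (auto simp: domH_def)
    have S: "S = {a..c}"
      unfolding S_def using c True le_less_trans[of _ "ereal c" b] by auto
    show ?thesis
      unfolding S using meas[OF c(2)] val[OF c(2)] ge1[OF c(2)] True c(1) by (simp add: y2_def)
  next
    case False
    then have xb: "x = b" using x by (auto simp: domH_def)
    have "ereal a < b" using H by (simp add: hamiltonian_def)
    \<comment> \<open>Exhausting [a,b) by [a, X n], monotone convergence handles the integral of
      \<psi>, while integrability in the equation at b gives convergence of y2 (X n) to the entry of
      W at b; the two limits are then identified.\<close>
    from ereal_incseq_approx[OF this] obtain X where X: "incseq X" "\<And>n. ereal a < X n" "\<And>n. X n < b"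
      "(\<lambda>n. ereal (X n)) \<longlonglongrightarrow> b" by blast
    have aX: "a \<le> X n" for n using X(2)[of n] by simp
    have S: "S = (\<Union>n. {a..X n})"
    proof (intro equalityI subsetI)
      fix t assume "t \<in> S"
      then have "a \<le> t" "ereal t < b" by (auto simp: S_def)
      then have "eventually (\<lambda>n. ereal t < ereal (X n)) sequentially"
        by (intro order_tendstoD(1)[OF X(4)])
      then obtain n where "ereal t < ereal (X n)" by (auto simp: eventually_sequentially)
      with \<open>a \<le> t\<close> show "t \<in> (\<Union>n. {a..X n})" by (auto intro!: exI[of _ n])
    next
      fix t assume "t \<in> (\<Union>n. {a..X n})"
      then obtain n where n: "a \<le> t" "t \<le> X n" by auto
      then have "ereal t < b" using X(3)[of n] by (meson ereal_less_eq(3) le_less_trans)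
      then show "t \<in> S" using n xb by (simp add: S_def)
    qed
    have inc: "incseq (\<lambda>n. {a..X n})"
      using X(1) by (auto simp: incseq_def intro: order_trans)
    define f where "f n t = ennreal (\<psi> t) * indicator {a..X n} t" for n t
    define F where "F t = ennreal (\<psi> t) * indicator S t" for t
    have fm: "f n \<in> borel_measurable lborel" for n
      unfolding f_def using meas[OF aX X(3)] .
    have lim: "(\<lambda>n. f n t) \<longlonglongrightarrow> F t" for t
    proof (cases "t \<in> S")
      case True
      then obtain n where n: "t \<in> {a..X n}" unfolding S by blast
      have "f m t = F t" if "m \<ge> n" for m
        using n incseqD[OF inc that] True by (auto simp: f_def F_def indicator_def)
      then show ?thesis by (intro tendsto_eventually) (auto simp: eventually_sequentially)
    next
      case False
      then have "f n t = F t" for n unfolding S by (auto simp: f_def F_def S indicator_def)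
      then show ?thesis by simp
    qed
    have Fm: "F \<in> borel_measurable lborel"
      by (rule borel_measurable_LIMSEQ_order[OF lim fm])
    have "f m t \<le> f n t" if "m \<le> n" for m n t
      using incseqD[OF inc that] by (auto simp: f_def indicator_def)
    then have "incseq f"
      by (auto simp: incseq_def le_fun_def)
    then have "(\<lambda>n. integral\<^sup>N lborel (f n)) \<longlonglongrightarrow> integral\<^sup>N lborel F"
      using fm lim by (intro nn_integral_LIMSEQ)
    then have L1: "(\<lambda>n. ennreal (ln (cmod (y2 (X n))))) \<longlonglongrightarrow> integral\<^sup>N lborel F"
      unfolding f_def val[OF aX X(3)] .
    let ?T = "{t. a \<le> t \<and> ereal t \<le> x}"
    let ?k = "\<lambda>t. W t (\<i> * r) $ 2 $ 1 * h1 t + W t (\<i> * r) $ 2 $ 2 * h3 t"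
    note Fx = fundamental_solution_row[OF W x, of "\<i> * r"]
    \<comment> \<open>For finite b the sets differ by the point b. For b = \<infinity> the value
      \<open>real_of_ereal b\<close> is 0, and the difference is empty.\<close>
    have ST: "S \<subseteq> ?T" "?T - S \<subseteq> {real_of_ereal b}"
      by (auto simp: S_def xb less_le)
    have "set_integrable lborel S ?k"
      by (rule set_integrable_subset[OF Fx(2)]) (use ST(1) in \<open>auto simp: S\<close>)
    then have "(\<lambda>n. LINT t:{a..X n}|lborel. ?k t) \<longlonglongrightarrow> (LINT t:S|lborel. ?k t)"
      unfolding S by (intro set_integral_cont_up inc) auto
    also have "(LINT t:S|lborel. ?k t) = (LINT t:?T|lborel. ?k t)"
      by (rule set_integral_discrete_difference[where X="{real_of_ereal b}"]) (use ST in auto)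
    finally have "(\<lambda>n. 1 + (\<i> * r) * (LINT t:{a..X n}|lborel. ?k t)) \<longlonglongrightarrow> W x (\<i> * r) $ 2 $ 2"
      unfolding Fx(4) by (intro tendsto_intros)
    moreover have "1 + (\<i> * r) * (LINT t:{a..X n}|lborel. ?k t) = y2 (X n)" for n
      using canonical_row.y2[OF row[OF aX[of n] X(3)[of n]], of "X n"] aX[of n] by (simp add: y1_def y2_def)
    ultimately have "(\<lambda>n. y2 (X n)) \<longlonglongrightarrow> W x (\<i> * r) $ 2 $ 2" by simp
    then have L2: "(\<lambda>n. cmod (y2 (X n))) \<longlonglongrightarrow> cmod (W x (\<i> * r) $ 2 $ 2)"
      by (rule tendsto_norm)
    \<comment> \<open>The bound 1 survives the limit and keeps it in the domain where ln is
      continuous.\<close>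
    have g: "1 \<le> cmod (W x (\<i> * r) $ 2 $ 2)"
      using ge1[OF aX X(3)] by (intro LIMSEQ_le_const[OF L2]) auto
    then have "(\<lambda>n. ennreal (ln (cmod (y2 (X n))))) \<longlonglongrightarrow> ennreal (ln (cmod (W x (\<i> * r) $ 2 $ 2)))"
      by (intro tendsto_ennrealI tendsto_ln L2) auto
    with L1 have "integral\<^sup>N lborel F = ennreal (ln (cmod (W x (\<i> * r) $ 2 $ 2)))"
      by (rule LIMSEQ_unique)
    with Fm g show ?thesis unfolding F_def by blast
  qed
  then show "(\<lambda>t. ennreal (\<psi> t) * indicator S t) \<in> borel_measurable lborel"
    and "(\<integral>\<^sup>+t\<in>S. ennreal (\<psi> t) \<partial>lborel) = ennreal (ln (cmod (W x (\<i> * r) $ 2 $ 2)))"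
    and "0 \<le> ln (cmod (W x (\<i> * r) $ 2 $ 2))"
    by auto
qed

text \<open>The two summands of the kernel have disjoint supports, so each t belongs to one regime,
  and C1, C2 need only be weaker than the constants of both.\<close>

lemma kernel_bounds:
  assumes H: "hamiltonian a b h1 h2 h3" and W: "fundamental_solution a b h1 h2 h3 W"
    and cp: "compatible_pair a b h1 h2 h3 r0 cm cp that shat"
    and pos: "cm > 0" "cp > 0" "r0 \<ge> 0" and r_gt: "r > r0"
    and t: "a \<le> t" "ereal t < b" and h1: "h1 t \<ge> 0"
    and C1: "0 < C1" "C1 \<le> cm / (2 + 4 * cp)" "C1 \<le> 1 / (2 * ((2 + 4 * cp) / cp + 1))"
    and C2: "2 + 4 * cp \<le> C2" "(2 + 4 * cp) * (3 + 2 * (2 + 4 * cp)) * (1 + cp) \<le> C2"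
  defines "\<psi> \<equiv> canonical_row.log_rate r (\<lambda>t. W (ereal t) (\<i> * r) $ 2 $ 1) (\<lambda>t. W (ereal t) (\<i> * r) $ 2 $ 2) t * h1 t"
  shows "C1 * kernel a b h1 h2 h3 cp that shat t r \<le> \<psi>" "\<psi> \<le> C2 * kernel a b h1 h2 h3 cp that shat t r"
proof -
  have T: "that r \<in> ivl a b" "detOmega h1 h2 h3 a (that r) \<le> cp / r\<^sup>2"
    using cp r_gt unfolding compatible_pair_def by auto
  \<comment> \<open>For t < that r, monotonicity of the determinant is used up to
    \<open>that r\<close>, so the interval has to contain that point too.\<close>
  define c where "c = max t (that r)"
  have c: "a \<le> c" "ereal c < b" "t \<le> c" "that r \<le> c"
    using T t by (auto simp: c_def ivl_def max_def)
  have "r > 0" using r_gt pos by simp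
  interpret canonical_row a c r h1 h2 h3 "\<lambda>t. W (ereal t) (\<i> * r) $ 2 $ 1" "\<lambda>t. W (ereal t) (\<i> * r) $ 2 $ 2"
    using c \<open>r > 0\<close> by (intro hamiltonian_canonical_row[OF H W])
  have combine: "C1 * (k * h1 t) \<le> \<psi> \<and> \<psi> \<le> C2 * (k * h1 t)"
    if k: "k \<ge> 0" and b: "c1 * k \<le> log_rate t" "log_rate t \<le> c2 * k" and c12: "C1 \<le> c1" "c2 \<le> C2" for k c1 c2
  proof -
    have "C1 * k \<le> log_rate t" "log_rate t \<le> C2 * k"
      using mult_right_mono[OF c12(1) k] mult_right_mono[OF c12(2) k] b by linarith+
    then show ?thesis
      using mult_right_mono[OF _ h1] unfolding \<psi>_def mult.assoc[symmetric] by blast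
  qed
  have "C1 * kernel a b h1 h2 h3 cp that shat t r \<le> \<psi> \<and> \<psi> \<le> C2 * kernel a b h1 h2 h3 cp that shat t r"
  proof (cases "t < that r")
    case True
    define k where "k = omega h2 a t / (cp / r\<^sup>2 + (omega h3 a t)\<^sup>2)"
    have "detOmega h1 h2 h3 a t \<le> detOmega h1 h2 h3 a (that r)"
      using True t c by (intro detOmega_mono) auto
    then have "detOmega h1 h2 h3 a t \<le> cp / r\<^sup>2" using T by linarith
    note e = log_rate_bounds_of_det_le[OF _ pos(2) this, folded k_def]
    have "omega h2 a t \<ge> 0"
      using t c by (intro psd2D(2)[OF omega_psd]) auto
    then have "k \<ge> 0" unfolding k_def using pos by simp
    moreover have "kernel a b h1 h2 h3 cp that shat t r = k * h1 t"
      using True t by (simp add: kernel_def k_def)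
    ultimately show ?thesis
      using combine[OF _ e C1(3) C2(2)] t c by simp
  next
    case False
    define s where "s = shat t r"
    have "t \<in> ivl a b" using T False t by (auto simp: ivl_def)
    then have s: "a \<le> s" "s \<le> t" "cm / r\<^sup>2 \<le> detOmega h1 h2 h3 s t" "detOmega h1 h2 h3 s t \<le> cp / r\<^sup>2"
      using cp r_gt False unfolding compatible_pair_def s_def by auto
    note l = log_rate_bounds_of_det_ge[OF s(1,2) c(3) pos(1) s(3,4)]
    have "kernel a b h1 h2 h3 cp that shat t r = 1 / omega h1 s t * h1 t"
      using False t by (simp add: kernel_def s_def)
    then show ?thesis
      using combine[OF _ l(1,2) C1(2) C2(1)] l(3) by simp
  qed
  then show "C1 * kernel a b h1 h2 h3 cp that shat t r \<le> \<psi>" "\<psi> \<le> C2 * kernel a b h1 h2 h3 cp that shat t r"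
    by auto
qed

text \<open>Finiteness of the integral is part of the claim: L is real and C1 > 0, so the first
  inequality excludes I = \<infinity>. Uniformity of the constants lies in their being chosen before
  the Hamiltonian.\<close>

theorem theorem3p4:
  fixes cm cp :: real
  assumes "cm > 0" and "cp > 0"
  shows "\<exists>C1 C2. C1 > 0 \<and> C2 > 0 \<and>
    (\<forall>(a::real) (b::ereal) h1 h2 h3 (r0::real) that shat W.
       hamiltonian a b h1 h2 h3 \<and> definite a b h1 h2 h3 \<and> r0 \<ge> 0 \<and>
       compatible_pair a b h1 h2 h3 r0 cm cp that shat \<and>
       fundamental_solution a b h1 h2 h3 W \<longrightarrow>
       (\<forall>x \<in> domH a b h1 h2. \<forall>r. r > r0 \<longrightarrow>
          (let I = enn2ereal (\<integral>\<^sup>+ t\<in>{t. a \<le> t \<and> ereal t \<le> x}.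
                      ennreal (kernel a b h1 h2 h3 cp that shat t r) \<partial>lborel);
               L = ereal (ln (cmod (W x (\<i> * complex_of_real r) $ 2 $ 2)))
           in ereal C1 * I \<le> L \<and> L \<le> ereal C2 * I)))"
proof -
  \<comment> \<open>Minimum and maximum over the two regimes, with \<kappa> = 2 + 4 * cp written
    out.\<close>
  define C1 where "C1 = min (cm / (2 + 4 * cp)) (1 / (2 * ((2 + 4 * cp) / cp + 1)))"
  define C2 where "C2 = max (2 + 4 * cp) ((2 + 4 * cp) * (3 + 2 * (2 + 4 * cp)) * (1 + cp))"
  have "(2 + 4 * cp) / cp + 1 > 0" using assms by (intro add_pos_pos divide_pos_pos) auto
  then have "1 / (2 * ((2 + 4 * cp) / cp + 1)) > 0" by (intro divide_pos_pos mult_pos_pos) auto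
  then have C1: "C1 > 0" using assms unfolding C1_def by (simp add: min_less_iff_conj)
  have C2: "C2 > 0" using assms unfolding C2_def by (simp add: less_max_iff_disj)
  show ?thesis
  proof (rule exI[of _ C1], rule exI[of _ C2], intro conjI C1 C2 allI impI ballI; elim conjE)
    fix a b h1 h2 h3 r0 that shat W x r
    assume H: "hamiltonian a b h1 h2 h3" and r0: "(r0::real) \<ge> 0"
      and cp: "compatible_pair a b h1 h2 h3 r0 cm cp that shat"
      and W: "fundamental_solution a b h1 h2 h3 W" and x: "x \<in> domH a b h1 h2" and r: "r0 < r"
    have "r > 0" using r r0 by simp
    define \<psi> where "\<psi> t = canonical_row.log_rate r (\<lambda>t. W (ereal t) (\<i> * r) $ 2 $ 1)
      (\<lambda>t. W (ereal t) (\<i> * r) $ 2 $ 2) t * h1 t" for t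
    define S where "S = {t. a \<le> t \<and> ereal t \<le> x \<and> ereal t < b}"
    define T where "T = {t. a \<le> t \<and> ereal t \<le> x}"
    define L where "L = ln (cmod (W x (\<i> * r) $ 2 $ 2))"
    define K where "K t = kernel a b h1 h2 h3 cp that shat t r" for t
    define I where "I = (\<integral>\<^sup>+ t\<in>T. ennreal (K t) \<partial>lborel)"
    note \<psi>L = ln_w22_nn_integral[OF H W \<open>r > 0\<close> x, folded \<psi>_def, folded S_def, folded L_def]
    have scaled: "(\<integral>\<^sup>+t. ennreal C * (ennreal (\<psi> t) * indicator S t) \<partial>lborel) = ennreal (C * L)" if "C \<ge> 0" for C
      using that \<psi>L by (simp add: nn_integral_cmult ennreal_mult)
    \<comment> \<open>The sets can differ at b only. For b = \<infinity> the excluded point is 0,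
      harmless as a null set.\<close>
    have TS: "t \<in> T \<longleftrightarrow> t \<in> S" if "t \<noteq> real_of_ereal b" for t
      using that x by (auto simp: T_def S_def domH_def less_le)
    have "AE t in lborel. t \<in> ivl a b \<longrightarrow> psd2 (h1 t) (h2 t) (h3 t)"
      using H by (simp add: hamiltonian_def psd2_def)
    then have AE: "AE t in lborel. (t \<in> T \<longleftrightarrow> t \<in> S) \<and> (t \<in> S \<longrightarrow> C1 * K t \<le> \<psi> t \<and> \<psi> t \<le> C2 * K t)"
      using AE_lborel_singleton[of a] AE_lborel_singleton[of "real_of_ereal b"]
    proof eventually_elim
      case (elim t)
      have "C1 * K t \<le> \<psi> t \<and> \<psi> t \<le> C2 * K t" if "t \<in> S"
      proof -
        have t: "a \<le> t" "ereal t < b" using that by (auto simp: S_def)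
        then have "h1 t \<ge> 0" using elim by (auto simp: ivl_def dest: psd2D)
        from kernel_bounds[OF H W cp assms r0 r t this C1, of C2, folded \<psi>_def]
        show ?thesis unfolding K_def by (simp add: C1_def C2_def)
      qed
      then show ?case using TS elim by blast
    qed
    \<comment> \<open>The kernel need not be measurable, as shat is arbitrary; so the constants are moved to the side of \<psi>.\<close>
    have "I \<le> (\<integral>\<^sup>+t. ennreal (1 / C1) * (ennreal (\<psi> t) * indicator S t) \<partial>lborel)"
      unfolding I_def
    proof (rule nn_integral_mono_AE)
      show "AE t in lborel. ennreal (K t) * indicator T t \<le> ennreal (1 / C1) * (ennreal (\<psi> t) * indicator S t)"
        using AE
      proof eventually_elim
        case (elim t)
        show ?case
        proof (cases "t \<in> S")
          case True
          then have "K t \<le> 1 / C1 * \<psi> t" using elim C1 by (simp add: field_simps)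
          then have "ennreal (K t) \<le> ennreal (1 / C1 * \<psi> t)" by (rule ennreal_leI)
          also have "\<dots> = ennreal (1 / C1) * ennreal (\<psi> t)" using C1 by (intro ennreal_mult') simp
          finally show ?thesis using True elim by simp
        qed (use elim in simp)
      qed
    qed
    also have "\<dots> = ennreal (L / C1)" using scaled[of "1 / C1"] C1 by simp
    finally have "enn2ereal I \<le> enn2ereal (ennreal (L / C1))" by (simp add: less_eq_ennreal.rep_eq)
    \<comment> \<open>\<open>ennreal\<close> truncates negative reals to 0, so L \<ge> 0 is what
      allows the return to real values.\<close>
    then have "enn2ereal I \<le> ereal (L / C1)" using \<psi>L(3) C1 by (simp add: enn2ereal_ennreal)
    then have "ereal C1 * enn2ereal I \<le> ereal C1 * ereal (L / C1)"
      using C1 by (intro ereal_mult_left_mono) auto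
    then have lower: "ereal C1 * enn2ereal I \<le> ereal L" using C1 by simp
    have "ennreal (L / C2) = (\<integral>\<^sup>+t. ennreal (1 / C2) * (ennreal (\<psi> t) * indicator S t) \<partial>lborel)"
      using scaled[of "1 / C2"] C2 by simp
    also have "\<dots> \<le> I"
      unfolding I_def
    proof (rule nn_integral_mono_AE)
      show "AE t in lborel. ennreal (1 / C2) * (ennreal (\<psi> t) * indicator S t) \<le> ennreal (K t) * indicator T t"
        using AE
      proof eventually_elim
        case (elim t)
        show ?case
        proof (cases "t \<in> S")
          case True
          then have "1 / C2 * \<psi> t \<le> K t" using elim C2 by (simp add: field_simps)
          then have "ennreal (1 / C2 * \<psi> t) \<le> ennreal (K t)" by (rule ennreal_leI)
          moreover have "ennreal (1 / C2 * \<psi> t) = ennreal (1 / C2) * ennreal (\<psi> t)" using C2 by (intro ennreal_mult') simp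
          ultimately show ?thesis using True elim by simp
        qed simp
      qed
    qed
    finally have "enn2ereal (ennreal (L / C2)) \<le> enn2ereal I" by (simp add: less_eq_ennreal.rep_eq)
    then have "ereal (L / C2) \<le> enn2ereal I" using \<psi>L(3) C2 by (simp add: enn2ereal_ennreal)
    then have "ereal C2 * ereal (L / C2) \<le> ereal C2 * enn2ereal I"
      using C2 by (intro ereal_mult_left_mono) auto
    then have upper: "ereal L \<le> ereal C2 * enn2ereal I" using C2 by simp
    show "let I = enn2ereal (\<integral>\<^sup>+ t\<in>{t. a \<le> t \<and> ereal t \<le> x}.
                      ennreal (kernel a b h1 h2 h3 cp that shat t r) \<partial>lborel);
               L = ereal (ln (cmod (W x (\<i> * complex_of_real r) $ 2 $ 2)))
           in ereal C1 * I \<le> L \<and> L \<le> ereal C2 * I"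
      using lower upper unfolding Let_def I_def T_def K_def L_def by blast
  qed
qed

end
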